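(* Let $f\colon I\to I$ be a tent map of slope $\lambda\in(\sqrt2,2)$ on its dynamical interval $I=[a,b]$, with kneading sequence $\kappa(f)$. Suppose that $f$ is of rational interior type, with height $q(\kappa(f))=q\in\mathbb Q$. Then $s=\operatorname{rhe}(q)$ is the greatest element of $\{0,1\}^{\mathbb N}$ (with respect to the unimodal order $\preceq$) with the property that there is some $S\in J_f$ with $\overleftarrow S=s$.
   Context: **Tent maps.** $I=[a,b]$ is a compact interval and $f\colon I\to I$ is a (continuous) tent map of slope $\lambda\in(\sqrt2,2)$: there is $c\in(a,b)$ such that $f$ has constant slope $\lambda$ on $[a,c]$ and constant slope $-\lambda$ on $[c,b]$. $I$ is the dynamical interval (core) of $f$: $f(c)=b$ and $f(b)=a$. **Sequences.** $\mathbb N=\{0,1,2,\dots\}$. For $S\in\{0,1\}^{\mathbb Z}$, define $\overleftarrow S\in\{0,1\}^{\mathbb N}$ by $\overleftarrow S_r=S_{-1-r}$ for $r\ge0$. A word is even (odd) if it contains an even (odd) number of $1$s. $W^\infty$ denotes infinite repetition of the word $W$. **Unimodal order.** For distinct $s,t\in\{0,1\}^{\mathbb N}$, $s\prec t$ iff the word $s_0\ldots s_r$ is even, where $r\ge0$ is least with $s_r\ne t_r$. $\preceq$ is the corresponding non-strict order. **Itineraries and kneading sequence.** If $c$ is periodic of period $n$, let $\varepsilon(f)=0$ (resp. $1$) if an even (resp. odd) number of the points $f^r(c)$, $1\le r<n$, lie in $(c,b]$; the itinerary $j(x)\in\{0,1\}^{\mathbb N}$ of $x\in I$ has $j(x)_r=0$,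 $1$, or $\varepsilon(f)$ according as $f^r(x)\in[a,c)$, $f^r(x)\in(c,b]$, or $f^r(x)=c$; and $\kappa(f)=j(b)$. If $c$ is not periodic, $s\in\{0,1\}^{\mathbb N}$ is an itinerary of $x\in I$ if $f^r(x)\in[a,c]$ whenever $s_r=0$ and $f^r(x)\in[c,b]$ whenever $s_r=1$; and $\kappa(f)$ is the (unique) itinerary of $b$. **Inverse limit.** $\widehat I=\{\mathbf x\in I^{\mathbb Z}: f(x_r)=x_{r+1}\text{ for all }r\in\mathbb Z\}$. If $c$ is periodic, the unique itinerary $J(\mathbf x)\in\{0,1\}^{\mathbb Z}$ of $\mathbf x\in\widehat I$ has $J(\mathbf x)_r=0$, $1$, or $\varepsilon(f)$ according as $x_r\in[a,c)$, $x_r\in(c,b]$, or $x_r=c$. If $c$ is not periodic, $S\in\{0,1\}^{\mathbb Z}$ is an itinerary of $\mathbf x$ if $x_r\in[a,c]$ whenever $S_r=0$ and $x_r\in[c,b]$ whenever $S_r=1$. $J_f\subset\{0,1\}^{\mathbb Z}$ is the set of all itineraries of points of $\widehat I$. **Height.** All rationals $m/n$ are in lowest terms. For $q\in(0,1/2]$ and $i\ge1$, let $k_i(q)$ be two less than the number of vertical lines $x=\text{integer}$ in $\mathbb R^2$ which the line $y=qx$ intersects for $y\in[i-1,i]$. If $q=m/n$ is rational, let $c_q=10^{k_1(q)}110^{k_2(q)}11\ldots110^{k_m(q)}1\in\{0,1\}^{n+1}$. The height of $s\in\{0,1\}^{\mathbb N}$ is $q(s)=\inf\left(\{q\in(0,1/2]\cap\mathbb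 Q:(c_q0)^\infty\prec s\}\cup\{1/2\}\right)\in[0,1/2]$. The condition $\lambda\in(\sqrt2,2)$ is equivalent to $q(\kappa(f))\in(0,1/2)$. For rational $q=m/n\in(0,1/2)$, let $w_q\in\{0,1\}^{n-1}$ consist of the first $n-1$ symbols of $c_q$ (so $c_q=w_q01$), let $\widehat w_q$ be the reverse of $w_q$, and set $\operatorname{lhe}(q)=(w_q1)^\infty$, $\operatorname{rhe}(q)=c_q(1\widehat w_q)^\infty$. **Types.** $f$ is of *rational interior type* if $q=q(\kappa(f))$ is rational and $\kappa(f)$ is not equal to $\operatorname{lhe}(q')$ or $\operatorname{rhe}(q')$ for any rational $q'\in(0,1/2)$. *)

theory Defs
  imports "HOL-Analysis.Analysis" "HOL-Library.Z2"
begin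

text \<open>
  The symbols $0$ and $1$ are the two elements of \<^typ>\<open>bit\<close>; its arithmetic is never used.
  Words are lists, one-sided sequences have type \<^typ>\<open>nat \<Rightarrow> bit\<close> and two-sided
  sequences have type \<^typ>\<open>int \<Rightarrow> bit\<close>.
\<close>

subsection \<open>Words and sequences\<close>

definition even_word :: "bit list \<Rightarrow> bool" where
  "even_word w \<longleftrightarrow> even (count_list w 1)"

definition word_omega :: "bit list \<Rightarrow> nat \<Rightarrow> bit" where
  "word_omega w = (\<lambda>r. w ! (r mod length w))"

definition prepend :: "bit list \<Rightarrow> (nat \<Rightarrow> bit) \<Rightarrow> nat \<Rightarrow> bit" where
  "prepend w s = (\<lambda>r. if r < length w then w ! r else s (r - length w))"

definition backward :: "(int \<Rightarrow> bit) \<Rightarrow> nat \<Rightarrow> bit" where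
  "backward S = (\<lambda>r. S (- 1 - int r))"

definition unimodal_less :: "(nat \<Rightarrow> bit) \<Rightarrow> (nat \<Rightarrow> bit) \<Rightarrow> bool" where
  "unimodal_less s t \<longleftrightarrow>
     s \<noteq> t \<and> (let r = (LEAST r. s r \<noteq> t r) in even_word (map s [0..<Suc r]))"

definition unimodal_le :: "(nat \<Rightarrow> bit) \<Rightarrow> (nat \<Rightarrow> bit) \<Rightarrow> bool" where
  "unimodal_le s t \<longleftrightarrow> s = t \<or> unimodal_less s t"

subsection \<open>Tent maps on their dynamical interval\<close>

text \<open>
  The map \<open>f\<close> is a total function on the reals, but only its restriction to \<open>{a..b}\<close>
  is constrained, and only that restriction matters for the notions below.
\<close>

definition constant_slope_on :: "real set \<Rightarrow> real \<Rightarrow> (real \<Rightarrow> real) \<Rightarrow> bool" where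
  "constant_slope_on A l f \<longleftrightarrow> (\<forall>x\<in>A. \<forall>y\<in>A. f y - f x = l * (y - x))"

definition tent_map :: "real \<Rightarrow> real \<Rightarrow> real \<Rightarrow> real \<Rightarrow> (real \<Rightarrow> real) \<Rightarrow> bool" where
  "tent_map a b c l f \<longleftrightarrow>
     a < c \<and> c < b \<and> f ` {a..b} \<subseteq> {a..b} \<and> continuous_on {a..b} f \<and>
     constant_slope_on {a..c} l f \<and> constant_slope_on {c..b} (- l) f \<and>
     f c = b \<and> f b = a"

subsection \<open>Itineraries and the kneading sequence\<close>

definition periodic :: "('a \<Rightarrow> 'a) \<Rightarrow> 'a \<Rightarrow> bool" where
  "periodic f x \<longleftrightarrow> (\<exists>n\<ge>1. (f ^^ n) x = x)"

definition period :: "('a \<Rightarrow> 'a) \<Rightarrow> 'a \<Rightarrow> nat" where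
  "period f x = (LEAST n. n \<ge> 1 \<and> (f ^^ n) x = x)"

definition turning_symbol :: "real \<Rightarrow> real \<Rightarrow> (real \<Rightarrow> real) \<Rightarrow> bit" where
  "turning_symbol b c f =
     (if even (card {r. 1 \<le> r \<and> r < period f c \<and> (f ^^ r) c \<in> {c<..b}}) then 0 else 1)"

text \<open>
  The symbol of a point when the turning point is periodic. It is applied only to points of
  \<open>{a..b}\<close>, so the final case is that of a point equal to \<open>c\<close>.
\<close>

definition address :: "real \<Rightarrow> real \<Rightarrow> real \<Rightarrow> (real \<Rightarrow> real) \<Rightarrow> real \<Rightarrow> bit" where
  "address a b c f x =
     (if x \<in> {a..<c} then 0 else if x \<in> {c<..b} then 1 else turning_symbol b c f)"

definition is_itinerary ::
    "real \<Rightarrow> real \<Rightarrow> real \<Rightarrow> (real \<Rightarrow> real) \<Rightarrow> real \<Rightarrow> (nat \<Rightarrow> bit) \<Rightarrow> bool" where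
  "is_itinerary a b c f x s \<longleftrightarrow>
     (if periodic f c then (\<forall>r. s r = address a b c f ((f ^^ r) x))
      else (\<forall>r. (s r = 0 \<longrightarrow> (f ^^ r) x \<in> {a..c}) \<and> (s r = 1 \<longrightarrow> (f ^^ r) x \<in> {c..b})))"

text \<open>
  For a tent map, the itinerary of \<open>b\<close> is unique also when \<open>c\<close> is not periodic, since the
  orbit of \<open>b = f c\<close> then avoids \<open>c\<close>.
\<close>

definition kneading :: "real \<Rightarrow> real \<Rightarrow> real \<Rightarrow> (real \<Rightarrow> real) \<Rightarrow> nat \<Rightarrow> bit" where
  "kneading a b c f = (THE s. is_itinerary a b c f b s)"

subsection \<open>The inverse limit\<close>

definition inverse_limit :: "real \<Rightarrow> real \<Rightarrow> (real \<Rightarrow> real) \<Rightarrow> (int \<Rightarrow> real) set" where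
  "inverse_limit a b f = {X. \<forall>r. X r \<in> {a..b} \<and> f (X r) = X (r + 1)}"

definition is_biitinerary ::
    "real \<Rightarrow> real \<Rightarrow> real \<Rightarrow> (real \<Rightarrow> real) \<Rightarrow> (int \<Rightarrow> real) \<Rightarrow> (int \<Rightarrow> bit) \<Rightarrow> bool" where
  "is_biitinerary a b c f X S \<longleftrightarrow>
     (if periodic f c then (\<forall>r. S r = address a b c f (X r))
      else (\<forall>r. (S r = 0 \<longrightarrow> X r \<in> {a..c}) \<and> (S r = 1 \<longrightarrow> X r \<in> {c..b})))"

definition biitineraries :: "real \<Rightarrow> real \<Rightarrow> real \<Rightarrow> (real \<Rightarrow> real) \<Rightarrow> (int \<Rightarrow> bit) set" where
  "biitineraries a b c f = {S. \<exists>X\<in>inverse_limit a b f. is_biitinerary a b c f X S}"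

subsection \<open>Height\<close>

text \<open>
  The line $y = qx$ meets the vertical line $x = j$ at height $qj$. For $0 < q \le 1/2$ the
  set below is finite with at least two elements, so the subtraction does not truncate.
\<close>

definition line_count :: "real \<Rightarrow> nat \<Rightarrow> nat" where
  "line_count q i = card {j::int. q * of_int j \<in> {real i - 1..real i}} - 2"

definition numer :: "rat \<Rightarrow> nat" where
  "numer q = nat (fst (quotient_of q))"

definition denom :: "rat \<Rightarrow> nat" where
  "denom q = nat (snd (quotient_of q))"

text \<open>
  $10^{k_1}110^{k_2}11\ldots110^{k_m}1$ is the concatenation of the $m$ blocks $10^{k_i}1$.
\<close>

definition c_word :: "rat \<Rightarrow> bit list" where
  "c_word q = concat (map (\<lambda>i. [1] @ replicate (line_count (of_rat q) i) 0 @ [1])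
                          [1..<Suc (numer q)])"

definition w_word :: "rat \<Rightarrow> bit list" where
  "w_word q = take (denom q - 1) (c_word q)"

definition height :: "(nat \<Rightarrow> bit) \<Rightarrow> real" where
  "height s = Inf (real_of_rat ` {q. 0 < q \<and> q \<le> 1 / 2 \<and>
                                     unimodal_less (word_omega (c_word q @ [0])) s} \<union> {1 / 2})"

definition lhe :: "rat \<Rightarrow> nat \<Rightarrow> bit" where
  "lhe q = word_omega (w_word q @ [1])"

definition rhe :: "rat \<Rightarrow> nat \<Rightarrow> bit" where
  "rhe q = prepend (c_word q) (word_omega ([1] @ rev (w_word q)))"

definition rational_interior_type ::
    "real \<Rightarrow> real \<Rightarrow> real \<Rightarrow> (real \<Rightarrow> real) \<Rightarrow> bool" where
  "rational_interior_type a b c f \<longleftrightarrow>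
     height (kneading a b c f) \<in> \<rat> \<and>
     (\<forall>q'::rat. 0 < q' \<and> q' < 1 / 2 \<longrightarrow>
        kneading a b c f \<noteq> lhe q' \<and> kneading a b c f \<noteq> rhe q')"

end

theory Submission
  imports Defs
begin

text \<open>
  Write \<open>q = m / n\<close> and \<open>\<theta> = n / m\<close>, and let \<open>\<kappa>\<close> be the kneading sequence. The line \<open>y = q x\<close>
  reaches height \<open>j\<close> at \<open>x = j \<theta>\<close>. The ones of \<open>rhe q\<close> stand at \<open>0\<close> and at the adjacent pairs of
  positions \<open>\<lfloor>j \<theta>\<rfloor>\<close>, \<open>\<lfloor>j \<theta>\<rfloor> + 1\<close> with \<open>j \<ge> 1\<close> (\<open>rhe_pair_seq\<close>). A prefix of such a sequence that
  ends just before a pair has an odd number of ones, so the unimodal order compares sequences of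
  this shape by their pairs: the one whose first differing pair lies further to the right is
  greater (\<open>paired_less\<close>). The theorem thereby becomes two inequalities for the floor function.

  No past exceeds \<open>rhe q\<close> (\<open>backward_le_rhe\<close>). If the past \<open>t\<close> of a two-sided itinerary did, it
  would follow \<open>rhe q\<close> up to its \<open>k\<close>-th pair and have a \<open>0\<close> there. Let \<open>L > \<lfloor>k \<theta>\<rfloor>\<close> be the next
  position at which \<open>t\<close> has a \<open>1\<close>; it exists because an orbit cannot stay to the left of the
  turning point for all sufficiently negative times. The forward sequence that starts at that
  symbol has its \<open>j\<close>-th pair at \<open>L - \<lfloor>(k - j) \<theta>\<rfloor> - 1 \<ge> \<lfloor>j \<theta>\<rfloor>\<close> for \<open>j < k\<close>, by superadditivity of
  the floor, and at \<open>L > \<lfloor>k \<theta>\<rfloor>\<close> for \<open>j = k\<close>. So it is greater than \<open>rhe q\<close>, hence greater than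
  \<open>\<kappa>\<close>, which no forward part of an itinerary can be.

  The past \<open>rhe q\<close> occurs (\<open>rhe_attained\<close>). It is continued by the itinerary \<open>v\<close> of a point just
  below \<open>b\<close> whose orbit avoids the turning point. The same computation with
  \<open>\<lfloor>(i + j) \<theta>\<rfloor> \<le> \<lfloor>i \<theta>\<rfloor> + \<lfloor>j \<theta>\<rfloor> + 1\<close> shows that no forward part of this two-sided sequence
  exceeds \<open>\<kappa>\<close>, except that ties between pairs must be decided by \<open>v\<close>; they are, since \<open>v\<close> starts
  with \<open>1 0\<close> and is not exceeded by \<open>\<kappa>\<close> shifted by \<open>n\<close>. A two-sided sequence with this property
  and with ones arbitrarily far to the left describes an orbit (\<open>realize\<close>): the forward parts
  determine points through a power series in \<open>1 / \<lambda>\<close>, the \<open>depth\<close>, and comparison with \<open>\<kappa>\<close> keeps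
  these points inside \<open>[a, b]\<close>. As the orbit avoids the turning point if that is periodic, the
  sequence is an itinerary of the orbit (\<open>biitineraries_intro\<close>).

  The slope bounds give \<open>0 < q < 1 / 2\<close> (\<open>height_K_pos\<close>, \<open>height_K_less_half\<close>). Beyond that,
  height and interior type enter through two consequences: \<open>\<kappa>\<close> is less than \<open>rhe q\<close>
  (\<open>K_less_rhe\<close>) and starts with the word \<open>c_word q\<close> (\<open>K_prefix\<close>). For \<open>q'\<close> slightly below \<open>q\<close>
  the word \<open>c_word q'\<close> agrees with \<open>rhe q\<close> as far as desired, and for \<open>q'\<close> slightly above \<open>q\<close> it
  agrees with \<open>lhe q\<close>. Therefore height \<open>q\<close> forces \<open>\<kappa> \<le> rhe q\<close>, and \<open>lhe q \<le> \<kappa>\<close> unless \<open>\<kappa>\<close>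
  starts with \<open>c_word q\<close> anyway. A sequence strictly between the two that is not exceeded by its
  own shifts has to start with \<open>c_word q\<close>.
\<close>

section \<open>The unimodal order\<close>

definition shift :: "nat \<Rightarrow> (nat \<Rightarrow> bit) \<Rightarrow> nat \<Rightarrow> bit" where
  "shift k s = (\<lambda>r. s (k + r))"

definition ones :: "(nat \<Rightarrow> bit) \<Rightarrow> nat \<Rightarrow> nat" where
  "ones s r = count_list (map s [0..<r]) 1"

lemma shift_0 [simp]: "shift 0 s = s" and shift_shift [simp]: "shift j (shift k s) = shift (k + j) s"
  and shift_apply: "shift k s r = s (k + r)"
  by (simp_all add: shift_def add.assoc)

lemma ones_0 [simp]: "ones s 0 = 0"
  and ones_Suc: "ones s (Suc r) = ones s r + (if s r = 1 then 1 else 0)"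
  by (simp_all add: ones_def)

lemma ones_cong: "(\<And>i. i < r \<Longrightarrow> s i = t i) \<Longrightarrow> ones s r = ones t r"
  by (induction r) (auto simp: ones_Suc)

lemma ones_add: "ones s (k + r) = ones s k + ones (shift k s) r"
  by (induction r) (auto simp: ones_Suc shift_apply)

lemma bit_eqI: "(x = 1 \<longleftrightarrow> y = 1) \<Longrightarrow> x = (y :: bit)"
  by (cases x; cases y) auto

lemma unimodal_less_iff:
  "unimodal_less s t \<longleftrightarrow> (\<exists>r. (\<forall>i<r. s i = t i) \<and> s r \<noteq> t r \<and> even (ones s (Suc r)))"
proof
  assume *: "unimodal_less s t"
  then have "\<exists>r. s r \<noteq> t r"
    by (auto simp: unimodal_less_def)
  then have "s (LEAST r. s r \<noteq> t r) \<noteq> t (LEAST r. s r \<noteq> t r)"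
    by (rule LeastI_ex)
  moreover have "\<forall>i<(LEAST r. s r \<noteq> t r). s i = t i"
    using not_less_Least by blast
  ultimately show "\<exists>r. (\<forall>i<r. s i = t i) \<and> s r \<noteq> t r \<and> even (ones s (Suc r))"
    using * unfolding unimodal_less_def even_word_def ones_def Let_def by blast
next
  assume "\<exists>r. (\<forall>i<r. s i = t i) \<and> s r \<noteq> t r \<and> even (ones s (Suc r))"
  then obtain r where r: "\<forall>i<r. s i = t i" "s r \<noteq> t r" "even (ones s (Suc r))"
    by blast
  have "(LEAST r. s r \<noteq> t r) = r"
    using r by (intro Least_equality) (auto intro: leI)
  then show "unimodal_less s t"
    using r unfolding unimodal_less_def even_word_def ones_def Let_def by auto
qed

lemma first_difference:
  assumes "s \<noteq> (t :: nat \<Rightarrow> bit)"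
  obtains r where "\<forall>i<r. s i = t i" "s r \<noteq> t r"
proof -
  have "\<exists>r. s r \<noteq> t r"
    using assms by auto
  then have "s (LEAST r. s r \<noteq> t r) \<noteq> t (LEAST r. s r \<noteq> t r)"
    by (rule LeastI_ex)
  moreover have "\<forall>i<(LEAST r. s r \<noteq> t r). s i = t i"
    using not_less_Least by blast
  ultimately show ?thesis
    using that by blast
qed

text \<open>
  Exactly one of the two sequences has a \<open>1\<close> at the first difference, so the two prefixes have
  opposite parities. This makes the unimodal order total and antisymmetric.
\<close>

lemma ones_Suc_differ:
  assumes "\<forall>i<r. s i = t i" "s r \<noteq> t r"
  shows "even (ones t (Suc r)) \<longleftrightarrow> odd (ones s (Suc r))"
proof -
  have "ones s r = ones t r"
    using assms by (intro ones_cong) auto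
  then show ?thesis
    using assms(2) by (cases "s r"; cases "t r") (auto simp: ones_Suc)
qed

lemma unimodal_linear: "s = t \<or> unimodal_less s t \<or> unimodal_less t s"
proof (cases "s = t")
  case False
  then obtain r where r: "\<forall>i<r. s i = t i" "s r \<noteq> t r"
    by (rule first_difference)
  show ?thesis
  proof (cases "even (ones s (Suc r))")
    case True
    then show ?thesis using r by (auto simp: unimodal_less_iff)
  next
    case False
    then have "even (ones t (Suc r))"
      using ones_Suc_differ[OF r] by simp
    then show ?thesis using r by (auto simp: unimodal_less_iff intro!: exI[of _ r])
  qed
qed auto

lemma unimodal_less_asym: "unimodal_less s t \<Longrightarrow> \<not> unimodal_less t s"
proof
  assume "unimodal_less s t" "unimodal_less t s"
  then obtain r r' where r: "\<forall>i<r. s i = t i" "s r \<noteq> t r" "even (ones s (Suc r))"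
    and r': "\<forall>i<r'. t i = s i" "t r' \<noteq> s r'" "even (ones t (Suc r'))"
    unfolding unimodal_less_iff by blast
  have "r = r'"
    using r r' by (metis linorder_neqE_nat)
  then show False
    using ones_Suc_differ[OF r(1,2)] r(3) r'(3) by simp
qed

lemma unimodal_less_irrefl: "\<not> unimodal_less s s"
  using unimodal_less_asym by blast

lemma unimodal_le_iff: "unimodal_le s t \<longleftrightarrow> \<not> unimodal_less t s"
  using unimodal_linear unimodal_less_asym unimodal_less_irrefl unfolding unimodal_le_def by metis

text \<open>
  Only the symbols up to the first difference matter, so a strict inequality survives any change
  beyond it.
\<close>

lemma unimodal_less_agree:
  assumes "unimodal_less s t" "\<forall>i<r. s' i = s i" "\<forall>i<r. t' i = t i"
    and "\<exists>i<r. s i \<noteq> t i"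
  shows "unimodal_less s' t'"
proof -
  obtain p where p: "\<forall>i<p. s i = t i" "s p \<noteq> t p" "even (ones s (Suc p))"
    using assms(1) unfolding unimodal_less_iff by blast
  have "p < r"
    using assms(4) p by (meson leI order_less_le_trans)
  moreover have "ones s' (Suc p) = ones s (Suc p)"
    using assms(2) \<open>p < r\<close> by (intro ones_cong) auto
  ultimately show ?thesis
    using assms(2,3) p unfolding unimodal_less_iff by (intro exI[of _ p]) auto
qed

lemma unimodal_less_trans:
  assumes "unimodal_less s t" "unimodal_less t u"
  shows "unimodal_less s u"
proof -
  obtain p where p: "\<forall>i<p. s i = t i" "s p \<noteq> t p" "even (ones s (Suc p))"
    using assms(1) unfolding unimodal_less_iff by blast
  obtain r where r: "\<forall>i<r. t i = u i" "t r \<noteq> u r" "even (ones t (Suc r))"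
    using assms(2) unfolding unimodal_less_iff by blast
  consider "p < r" | "r < p" | "p = r" by linarith
  then show ?thesis
  proof cases
    case 1
    then show ?thesis using p r unfolding unimodal_less_iff by (intro exI[of _ p]) auto
  next
    case 2
    then have "ones s (Suc r) = ones t (Suc r)"
      using p by (intro ones_cong) auto
    then show ?thesis using 2 p r unfolding unimodal_less_iff by (intro exI[of _ r]) auto
  next
    case 3
    then show ?thesis using p r ones_Suc_differ[OF p(1,2)] by simp
  qed
qed

lemma unimodal_le_refl [simp]: "unimodal_le s s"
  by (simp add: unimodal_le_def)

lemma unimodal_le_less_trans: "unimodal_le s t \<Longrightarrow> unimodal_less t u \<Longrightarrow> unimodal_less s u"
  using unimodal_less_trans unfolding unimodal_le_def by blast

text \<open>
  Cancelling a common prefix keeps the order if the prefix is even and reverses it if it is odd.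
\<close>

lemma unimodal_less_shift:
  assumes "\<forall>i<k. s i = t i"
  shows "unimodal_less s t \<longleftrightarrow>
    (if even (ones s k) then unimodal_less (shift k s) (shift k t)
     else unimodal_less (shift k t) (shift k s))"
proof (cases "s = t")
  case False
  then obtain r where r: "\<forall>i<r. s i = t i" "s r \<noteq> t r"
    by (rule first_difference)
  have "k \<le> r"
    using r assms by (meson leI)
  define p where "p = r - k"
  have rp: "r = k + p"
    using \<open>k \<le> r\<close> by (simp add: p_def)
  have p: "\<forall>i<p. shift k s i = shift k t i" "shift k s p \<noteq> shift k t p"
    using r by (auto simp: shift_apply rp)
  have less: "unimodal_less u v \<longleftrightarrow> even (ones u (Suc r))"
    if "\<forall>i<r. u i = v i" "u r \<noteq> v r" for u v r
    using that unimodal_less_asym[of u v] ones_Suc_differ[OF that]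
    unfolding unimodal_less_iff by (metis linorder_neqE_nat)
  have "ones s (Suc r) = ones s k + ones (shift k s) (Suc p)"
    using ones_add[of s k "Suc p"] by (simp add: rp)
  then show ?thesis
    using less[OF r] less[OF p] less[of p "shift k t" "shift k s"] p ones_Suc_differ[OF p] by auto
qed (auto simp: unimodal_less_irrefl)

lemma unimodal_between:
  assumes "unimodal_le s t" "unimodal_le t u" "\<forall>i<r. s i = u i"
  shows "\<forall>i<r. t i = u i"
proof (rule ccontr)
  assume *: "\<not> (\<forall>i<r. t i = u i)"
  then have "t \<noteq> u" "s \<noteq> t"
    using assms(3) by auto
  then have "unimodal_less s t" "unimodal_less t u"
    using assms by (auto simp: unimodal_le_def)
  moreover have "unimodal_less t s"
    by (rule unimodal_less_agree[OF \<open>unimodal_less t u\<close>, of r]) (use assms(3) * in auto)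
  ultimately show False
    using unimodal_less_asym by blast
qed

lemma unimodal_less_01: "s 0 = 0 \<Longrightarrow> t 0 = 1 \<Longrightarrow> unimodal_less s t"
  unfolding unimodal_less_iff by (intro exI[of _ 0]) (auto simp: ones_Suc)

lemma unimodal_less_11_10:
  "s 0 = 1 \<Longrightarrow> s 1 = 1 \<Longrightarrow> t 0 = 1 \<Longrightarrow> t 1 = 0 \<Longrightarrow> unimodal_less s t"
  unfolding unimodal_less_iff by (intro exI[of _ 1]) (auto simp: ones_Suc)

lemma ones_periodic:
  assumes "\<forall>r. s (r + N) = s r"
  shows "ones s (d * N) = d * ones s N"
proof (induction d)
  case (Suc d)
  have "s (r + d * N) = s r" for r d
    using assms by (induction d) (auto simp: add.assoc[symmetric] add.commute[of N])
  then have "ones (shift (d * N) s) N = ones s N"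
    by (intro ones_cong) (simp add: shift_apply add.commute)
  then show ?case
    using Suc ones_add[of s "d * N" N] by (simp add: add.commute)
qed simp

lemma ones_card: "ones s r = card {i. i < r \<and> s i = 1}"
proof (induction r)
  case (Suc r)
  have "{i. i < Suc r \<and> s i = 1} =
      (if s r = 1 then insert r {i. i < r \<and> s i = 1} else {i. i < r \<and> s i = 1})"
    by (auto simp: less_Suc_eq)
  then show ?case
    using Suc by (auto simp: ones_Suc)
qed simp

section \<open>Sequences whose ones come in pairs\<close>

definition spaced :: "(nat \<Rightarrow> nat) \<Rightarrow> nat \<Rightarrow> bool" where
  "spaced P k \<longleftrightarrow> 1 \<le> P 1 \<and> (\<forall>j. 1 \<le> j \<and> j < k \<longrightarrow> P j + 2 \<le> P (Suc j))"

text \<open>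
  Only the symbols before \<open>P k\<close> are constrained: the sequence starts with a \<open>1\<close> that belongs to
  no pair, and then has the first \<open>k - 1\<close> pairs of ones prescribed by \<open>P\<close>. Prefixes are what the
  order compares, and later symbols of the sequences at hand are often unknown.
\<close>

definition paired :: "(nat \<Rightarrow> nat) \<Rightarrow> nat \<Rightarrow> (nat \<Rightarrow> bit) \<Rightarrow> bool" where
  "paired P k s \<longleftrightarrow> spaced P k \<and> (\<forall>r<P k. s r = 1 \<longleftrightarrow>
     r = 0 \<or> (\<exists>j. 1 \<le> j \<and> j < k \<and> (r = P j \<or> r = Suc (P j))))"

lemma spacedD: "spaced P k \<Longrightarrow> 1 \<le> i \<Longrightarrow> i < j \<Longrightarrow> j \<le> k \<Longrightarrow> P i + 2 \<le> P j"
proof (induction j)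
  case (Suc j)
  have *: "P j + 2 \<le> P (Suc j)" if "1 \<le> j"
    using Suc.prems that by (auto simp: spaced_def)
  show ?case
    using Suc * by (cases "i = j") (auto simp: Suc_lessI)
qed auto

lemma spaced_pos: "spaced P k \<Longrightarrow> 1 \<le> j \<Longrightarrow> j \<le> k \<Longrightarrow> 1 \<le> P j"
  using spacedD[of P k 1 j] by (cases "j = 1") (auto simp: spaced_def)

lemma spaced_le: "spaced P k \<Longrightarrow> 1 \<le> i \<Longrightarrow> i \<le> j \<Longrightarrow> j \<le> k \<Longrightarrow> P i \<le> P j"
  using spacedD[of P k i j] by (cases "i = j") auto

lemma spaced_mono: "spaced P k \<Longrightarrow> j \<le> k \<Longrightarrow> spaced P j"
  by (auto simp: spaced_def)

lemma paired_mono: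
  assumes "paired P k s" "1 \<le> j" "j \<le> k"
  shows "paired P j s"
proof -
  have sp: "spaced P k"
    using assms by (auto simp: paired_def)
  have "P j \<le> P k"
    using spaced_le[OF sp, of j k] assms by auto
  have below: "i < j" if "r < P j" "1 \<le> i" "i < k" "r = P i \<or> r = Suc (P i)" for i r
  proof (rule ccontr)
    assume "\<not> i < j"
    then have "P j \<le> P i"
      using spaced_le[OF sp, of j i] assms that by auto
    then show False using that by auto
  qed
  have "s r = 1 \<longleftrightarrow> r = 0 \<or> (\<exists>i. 1 \<le> i \<and> i < j \<and> (r = P i \<or> r = Suc (P i)))"
    if "r < P j" for r
  proof -
    have "r < P k"
      using that \<open>P j \<le> P k\<close> by simp
    then have "s r = 1 \<longleftrightarrow> r = 0 \<or> (\<exists>i. 1 \<le> i \<and> i < k \<and> (r = P i \<or> r = Suc (P i)))"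
      using assms(1) unfolding paired_def by blast
    then show ?thesis
      using below[OF that] assms(3) order_less_le_trans[of _ j k] by blast
  qed
  then show ?thesis
    using spaced_mono[OF sp assms(3)] unfolding paired_def by blast
qed

text \<open>
  The initial \<open>1\<close> belongs to no pair and all further ones come in pairs, so a prefix is odd
  unless it separates the two members of a pair.
\<close>

lemma paired_parity:
  assumes "paired P k s" "1 \<le> r" "r \<le> P k"
  shows "odd (ones s r) \<longleftrightarrow> (\<forall>j. 1 \<le> j \<and> j < k \<longrightarrow> r \<noteq> Suc (P j))"
  using assms(2,3)
proof (induction r)
  case (Suc r)
  have sp: "spaced P k"
    using assms by (auto simp: paired_def)
  have apart: "P i \<noteq> Suc (P j)" if "1 \<le> i" "i < k" "1 \<le> j" "j < k" for i j
    using spacedD[OF sp, of i j] spacedD[OF sp, of j i] that by (cases i j rule: linorder_cases) auto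
  have s: "s r = 1 \<longleftrightarrow> r = 0 \<or> (\<exists>j. 1 \<le> j \<and> j < k \<and> (r = P j \<or> r = Suc (P j)))"
    using assms Suc.prems by (auto simp: paired_def)
  show ?case
  proof (cases "r = 0")
    case True
    then show ?thesis
      using s spaced_pos[OF sp] by (fastforce simp: ones_Suc)
  next
    case False
    let ?first = "\<exists>j. 1 \<le> j \<and> j < k \<and> r = P j"
    let ?second = "\<exists>j. 1 \<le> j \<and> j < k \<and> r = Suc (P j)"
    have "odd (ones s r) \<longleftrightarrow> \<not> ?second"
      using Suc False by auto
    moreover have "\<not> (?first \<and> ?second)"
      using apart by blast
    moreover have "s r = 1 \<longleftrightarrow> ?first \<or> ?second"
      using s False by blast
    ultimately have "odd (ones s (Suc r)) \<longleftrightarrow> \<not> ?first"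
      by (cases "s r = 1") (auto simp: ones_Suc simp del: bit_not_one_iff)
    then show ?thesis by auto
  qed
qed auto

lemma paired_odd:
  assumes "paired P k s" "1 \<le> k"
  shows "odd (ones s (P k))"
proof -
  have sp: "spaced P k"
    using assms by (auto simp: paired_def)
  show ?thesis
    using paired_parity[OF assms(1), of "P k"] spaced_pos[OF sp assms(2)] spacedD[OF sp, of _ k]
    by force
qed

lemma paired_cong:
  assumes "paired P k s" "paired Q k t" "\<forall>j. 1 \<le> j \<and> j < k \<longrightarrow> P j = Q j" "r < P k" "r < Q k"
  shows "s r = t r"
  using assms unfolding paired_def by (intro bit_eqI) auto

text \<open>
  At the first pair where \<open>P\<close> and \<open>Q\<close> differ, \<open>s\<close> has a \<open>1\<close> and \<open>t\<close> still has a \<open>0\<close>. The common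
  prefix is odd, so with this \<open>1\<close> the prefix of \<open>s\<close> is even, and \<open>s\<close> is the smaller sequence.
\<close>

lemma paired_less:
  assumes s: "paired P k s" "s (P k) = 1" and t: "paired Q k t"
    and le: "\<forall>j. 1 \<le> j \<and> j \<le> k \<longrightarrow> P j \<le> Q j"
    and lt: "1 \<le> i" "i \<le> k" "P i < Q i"
  shows "unimodal_less s t"
proof -
  define j where "j = (LEAST j. 1 \<le> j \<and> P j < Q j)"
  have j: "1 \<le> j" "P j < Q j"
    using LeastI[of "\<lambda>j. 1 \<le> j \<and> P j < Q j" i] lt by (auto simp: j_def)
  have "j \<le> i"
    unfolding j_def by (rule Least_le) (use lt in auto)
  then have "j \<le> k" using lt by simp
  have eq: "P l = Q l" if "1 \<le> l" "l < j" for l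
  proof -
    have "\<not> P l < Q l"
      using not_less_Least[of l "\<lambda>j. 1 \<le> j \<and> P j < Q j"] that unfolding j_def by blast
    moreover have "P l \<le> Q l"
      using le that \<open>j \<le> k\<close> by auto
    ultimately show ?thesis by simp
  qed
  have sj: "paired P j s" and tj: "paired Q j t"
    using paired_mono s t j \<open>j \<le> k\<close> by auto
  have spk: "spaced P k" and spQ: "spaced Q j"
    using s tj by (auto simp: paired_def)
  have one: "s (P j) = 1"
  proof (cases "j = k")
    case False
    then have "P j < P k"
      using spacedD[OF spk, of j k] j \<open>j \<le> k\<close> by auto
    then show ?thesis
      using s(1) j False \<open>j \<le> k\<close> unfolding paired_def by auto
  qed (use s in auto)
  have zero: "t (P j) \<noteq> 1"
  proof
    assume "t (P j) = 1"
    then have "P j = 0 \<or> (\<exists>l. 1 \<le> l \<and> l < j \<and> (P j = Q l \<or> P j = Suc (Q l)))"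
      using tj j unfolding paired_def by blast
    moreover have "P j \<noteq> 0"
      using spaced_pos[OF spk, of j] j \<open>j \<le> k\<close> by auto
    ultimately obtain l where l: "1 \<le> l" "l < j" "P j = P l \<or> P j = Suc (P l)"
      using eq by metis
    then show False
      using spacedD[OF spk, of l j] \<open>j \<le> k\<close> by auto
  qed
  show ?thesis
    unfolding unimodal_less_iff
  proof (intro exI[of _ "P j"] conjI allI impI)
    show "s r = t r" if "r < P j" for r
      by (rule paired_cong[OF sj tj]) (use eq that j in auto)
    show "s (P j) \<noteq> t (P j)"
      using one zero by simp
    show "even (ones s (Suc (P j)))"
      using paired_odd[OF sj] j one by (simp add: ones_Suc)
  qed
qed

lemma paired_agree: "paired P k s \<Longrightarrow> \<forall>r<P k. t r = s r \<Longrightarrow> paired P k t"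
  by (simp add: paired_def)

text \<open>
  The initial \<open>1\<close> acts as the second member of a pair whose first member would be at position
  \<open>-1\<close>; this is why the pairs are counted from \<open>1\<close>.
\<close>

definition pair_seq :: "(nat \<Rightarrow> nat) \<Rightarrow> nat \<Rightarrow> bit" where
  "pair_seq P r = (if r = 0 \<or> (\<exists>j\<ge>1. r = P j \<or> r = Suc (P j)) then 1 else 0)"

lemma pair_seq_1: "pair_seq P r = 1 \<longleftrightarrow> r = 0 \<or> (\<exists>j\<ge>1. r = P j \<or> r = Suc (P j))"
  by (simp add: pair_seq_def)

lemma pair_seq_paired:
  assumes "\<And>k. spaced P k" "1 \<le> k"
  shows "paired P k (pair_seq P)"
proof -
  have "j < k" if "r < P k" "1 \<le> j" "r = P j \<or> r = Suc (P j)" for j r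
  proof (rule ccontr)
    assume "\<not> j < k"
    then have "P k \<le> P j"
      using spaced_le[OF assms(1), of k j j] assms(2) by auto
    then show False using that by auto
  qed
  then have "pair_seq P r = 1 \<longleftrightarrow> r = 0 \<or> (\<exists>j. 1 \<le> j \<and> j < k \<and> (r = P j \<or> r = Suc (P j)))"
    if "r < P k" for r
    using that unfolding pair_seq_1 by blast
  then show ?thesis
    using assms(1)[of k] unfolding paired_def by blast
qed

lemma spaced_ge:
  assumes "\<And>k. spaced P k" "1 \<le> k"
  shows "k \<le> P k"
  using assms(2)
proof (induction k)
  case (Suc k)
  have "1 \<le> P 1" and "1 \<le> k \<Longrightarrow> P k + 2 \<le> P (Suc k)"
    using assms(1)[of "Suc k"] by (auto simp: spaced_def)
  with Suc show ?case by (cases "k = 0") auto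
qed auto

text \<open>
  A greater sequence can only leave \<open>pair_seq P\<close> at the first member of a pair, by the parity of
  the prefixes. So the strict inequality has a purely combinatorial form.
\<close>

lemma pair_seq_less_first_difference:
  assumes sp: "\<And>k. spaced P k" and "unimodal_less (pair_seq P) t"
  obtains k where "1 \<le> k" "\<forall>r<P k. t r = pair_seq P r" "t (P k) = 0"
proof -
  obtain r where r: "\<forall>i<r. pair_seq P i = t i" "pair_seq P r \<noteq> t r" "even (ones (pair_seq P) (Suc r))"
    using assms(2) unfolding unimodal_less_iff by blast
  have "Suc r \<le> P (Suc r)"
    by (rule spaced_ge[OF sp]) auto
  then obtain j where j: "1 \<le> j" "Suc r = Suc (P j)"
    using paired_parity[OF pair_seq_paired[OF sp], of "Suc r" "Suc r"] r(3) by auto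
  then have "pair_seq P r = 1"
    by (auto simp: pair_seq_1)
  then have "t r = 0"
    using r(2) by (cases "t r") auto
  then show ?thesis
    using that[of j] j r(1) by auto
qed

section \<open>Recovering a point from its itinerary\<close>

text \<open>
  A point with itinerary \<open>s\<close> under a tent map of slope \<open>l\<close> lies at distance
  \<open>(b - c) * depth l s\<close> below \<open>b\<close>. The series comes from iterating
  \<open>b - x = (b - c) \<plusminus> (b - f x) / l\<close>, with the minus sign to the right of \<open>c\<close>. It makes sense for
  every sequence, including those that are not itineraries.
\<close>

definition depth :: "real \<Rightarrow> (nat \<Rightarrow> bit) \<Rightarrow> real" where
  "depth l s = (\<Sum>k. (-1) ^ ones s k / l ^ k)"

lemma depth_summable:
  assumes "1 < (l :: real)"
  shows "summable (\<lambda>k. (-1) ^ ones s k / l ^ k)"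
proof (rule summable_comparison_test)
  show "summable (\<lambda>k. (1 / l) ^ k)"
    using assms by (intro summable_geometric) auto
  show "\<exists>N. \<forall>k\<ge>N. norm ((-1) ^ ones s k / l ^ k) \<le> (1 / l) ^ k"
    using assms by (auto simp: norm_divide norm_power power_one_over abs_mult power_abs)
qed

lemma depth_unfold:
  assumes "1 < l"
  shows "depth l s = 1 + (if s 0 = 1 then -1 else 1) * depth l (shift 1 s) / l"
proof -
  have *: "(-1) ^ ones s (Suc k) / l ^ Suc k =
      (if s 0 = 1 then -1 else 1) / l * ((-1) ^ ones (shift 1 s) k / l ^ k)" for k
    using ones_add[of s 1 k] by (simp add: ones_Suc)
  have "depth l s = 1 + (\<Sum>k. (-1) ^ ones s (Suc k) / l ^ Suc k)"
    using suminf_split_head[OF depth_summable[OF assms, of s]] by (simp add: depth_def)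
  also have "(\<Sum>k. (-1) ^ ones s (Suc k) / l ^ Suc k) =
      (if s 0 = 1 then -1 else 1) / l * depth l (shift 1 s)"
    unfolding * depth_def by (rule suminf_mult[OF depth_summable[OF assms]])
  finally show ?thesis by simp
qed

lemma depth_bounded:
  assumes "1 < l"
  shows "\<bar>depth l s\<bar> \<le> l / (l - 1)"
proof -
  have g: "summable (\<lambda>k. (1 / l) ^ k)"
    using assms by (intro summable_geometric) auto
  have n: "norm ((-1) ^ ones s k / l ^ k) = (1 / l) ^ k" for k
    using assms by (auto simp: norm_divide norm_power power_one_over abs_mult power_abs)
  have "norm (depth l s) \<le> (\<Sum>k. norm ((-1) ^ ones s k / l ^ k))"
    unfolding depth_def by (rule summable_norm) (simp only: n g)
  also have "\<dots> = (\<Sum>k. (1 / l) ^ k)"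
    by (simp only: n)
  also have "\<dots> = l / (l - 1)"
    using assms by (subst suminf_geometric) (auto simp: field_simps)
  finally show ?thesis by simp
qed

lemma depth_agree:
  assumes "1 < l" "\<forall>i<r. s i = t i"
  shows "depth l s - depth l t =
    (-1) ^ ones s r * (depth l (shift r s) - depth l (shift r t)) / l ^ r"
  using assms(2)
proof (induction r)
  case (Suc r)
  have "s r = t r" using Suc by auto
  have "depth l (shift r s) - depth l (shift r t) =
      (if s r = 1 then -1 else 1) * (depth l (shift (Suc r) s) - depth l (shift (Suc r) t)) / l"
    using depth_unfold[OF assms(1), of "shift r s"] depth_unfold[OF assms(1), of "shift r t"]
      \<open>s r = t r\<close> by (auto simp: shift_apply diff_divide_distrib)
  then show ?case
    using Suc by (auto simp: ones_Suc)
qed auto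

text \<open>
  The two sequences first differ where one orbit is to the left and the other to the right of
  the turning point. There the distances to \<open>b\<close> are \<open>1 + u / l\<close> and \<open>1 - v / l\<close> in units of
  \<open>b - c\<close>, and evenness of the prefix makes their difference count positively. Hence depth
  decreases with the unimodal order as long as all depths of shifts are nonnegative, that is, as
  long as the corresponding points do not lie above \<open>b\<close>.
\<close>

lemma unimodal_less_depth:
  assumes "1 < l" "unimodal_less s t"
  obtains r where "depth l s - depth l t =
    (depth l (shift (Suc r) s) + depth l (shift (Suc r) t)) / l ^ Suc r"
proof -
  obtain r where r: "\<forall>i<r. s i = t i" "s r \<noteq> t r" "even (ones s (Suc r))"
    using assms(2) unfolding unimodal_less_iff by blast
  have sign: "(-1 :: real) ^ ones s r = (if s r = 1 then -1 else 1)"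
    using r(3) by (auto simp: ones_Suc split: if_splits)
  have arith: "e * (1 + e * u / l - (1 - e * v / l)) / l ^ r = (u + v) / l ^ Suc r"
    if "e = 1 \<or> e = -1" for e u v :: real
    using that assms(1) by (auto simp: add_divide_distrib diff_divide_distrib)
  have "depth l s - depth l t =
      (-1) ^ ones s r * (depth l (shift r s) - depth l (shift r t)) / l ^ r"
    by (rule depth_agree[OF assms(1) r(1)])
  also have "depth l (shift r s) = 1 + (if s r = 1 then -1 else 1) * depth l (shift (Suc r) s) / l"
    using depth_unfold[OF assms(1), of "shift r s"] by (simp add: shift_apply)
  also have "depth l (shift r t) = 1 - (if s r = 1 then -1 else 1) * depth l (shift (Suc r) t) / l"
    using depth_unfold[OF assms(1), of "shift r t"] r(2)
    by (cases "s r"; cases "t r") (auto simp: shift_apply)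
  finally have "depth l s - depth l t =
      (depth l (shift (Suc r) s) + depth l (shift (Suc r) t)) / l ^ Suc r"
    unfolding sign by (rule trans) (rule arith, simp)
  then show ?thesis by (rule that)
qed

section \<open>Itineraries of a tent map\<close>

definition tail :: "int \<Rightarrow> (int \<Rightarrow> bit) \<Rightarrow> nat \<Rightarrow> bit" where
  "tail i S = (\<lambda>k. S (i + int k))"

lemma tail_0 [simp]: "tail i S 0 = S i"
  by (simp add: tail_def)

lemma shift_tail [simp]: "shift k (tail i S) = tail (i + int k) S"
  by (simp add: shift_def tail_def add.assoc)

lemma funpow_funpow: "(f ^^ r) ((f ^^ k) x) = (f ^^ (k + r)) x"
  by (simp add: funpow_add add.commute[of k])

locale tent =
  fixes a b c lam :: real and f :: "real \<Rightarrow> real"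
  assumes tent: "tent_map a b c lam f" and lam_gt: "sqrt 2 < lam" and lam_lt: "lam < 2"
begin

abbreviation K :: "nat \<Rightarrow> bit" where
  "K \<equiv> kneading a b c f"

text \<open>
  Both symbols are allowed at the turning point, whether or not it is periodic. This weaker
  notion covers the two cases in the definition of itineraries at once, and already determines
  the point.
\<close>

definition follows :: "real \<Rightarrow> (nat \<Rightarrow> bit) \<Rightarrow> bool" where
  "follows x s \<longleftrightarrow>
     (\<forall>r. (s r = 0 \<longrightarrow> (f ^^ r) x \<in> {a..c}) \<and> (s r = 1 \<longrightarrow> (f ^^ r) x \<in> {c..b}))"

lemma ac: "a < c" and cb: "c < b" and fc: "f c = b" and fb: "f b = a"
  using tent unfolding tent_map_def by auto

lemma f_in: "x \<in> {a..b} \<Longrightarrow> f x \<in> {a..b}"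
  using tent unfolding tent_map_def by blast

lemma lam_gt_1: "1 < lam"
proof -
  have "1 < sqrt 2" by simp
  then show ?thesis using lam_gt by linarith
qed

lemma f_left: "x \<in> {a..c} \<Longrightarrow> f x = b - lam * (c - x)"
proof -
  assume "x \<in> {a..c}"
  then have "f c - f x = lam * (c - x)"
    using tent ac unfolding tent_map_def constant_slope_on_def by auto
  then show ?thesis using fc by simp
qed

lemma f_right: "x \<in> {c..b} \<Longrightarrow> f x = b - lam * (x - c)"
proof -
  assume "x \<in> {c..b}"
  then have "f x - f c = - lam * (x - c)"
    using tent cb unfolding tent_map_def constant_slope_on_def by auto
  then show ?thesis using fc by simp
qed

lemma length_eq: "b - a = lam * (b - c)"
  using f_right[of b] cb fb by simp

lemma iterate_in: "x \<in> {a..b} \<Longrightarrow> (f ^^ r) x \<in> {a..b}"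
  using f_in by (induction r) auto

lemma only_preimage: "x \<in> {a..b} \<Longrightarrow> f x = b \<Longrightarrow> x = c"
  using f_left[of x] f_right[of x] lam_gt_1 by (cases "x \<le> c") auto

text \<open>
  The error between the two sides shrinks by the factor \<open>1 / lam\<close> when traced back one step, and
  it is bounded along the orbit, so it is zero.
\<close>

lemma follows_depth:
  assumes "x \<in> {a..b}" "follows x s"
  shows "(b - c) * depth lam s = b - x"
proof -
  define E where "E r = (b - c) * depth lam (shift r s) - (b - (f ^^ r) x)" for r
  have step: "\<bar>E r\<bar> = \<bar>E (Suc r)\<bar> / lam" for r
  proof -
    have d: "depth lam (shift r s) =
        1 + (if s r = 1 then -1 else 1) * depth lam (shift (Suc r) s) / lam"
      using depth_unfold[OF lam_gt_1, of "shift r s"] by (simp add: shift_apply)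
    have pt: "b - (f ^^ r) x = (b - c) + (if s r = 1 then -1 else 1) * (b - (f ^^ Suc r) x) / lam"
    proof (cases "s r = 0")
      case True
      then have "(f ^^ r) x \<in> {a..c}"
        using assms(2) by (auto simp: follows_def)
      from f_left[OF this] True show ?thesis
        using lam_gt_1 by (simp add: field_simps)
    next
      case False
      then have "(f ^^ r) x \<in> {c..b}"
        using assms(2) by (auto simp: follows_def)
      from f_right[OF this] False show ?thesis
        using lam_gt_1 by (simp add: field_simps)
    qed
    have arith: "(b - c) * (1 + e * u / lam) - ((b - c) + e * v / lam) = e * ((b - c) * u - v) / lam"
      for e u v :: real
      by (simp add: algebra_simps add_divide_distrib diff_divide_distrib)
    have "E r = (if s r = 1 then -1 else 1) * E (Suc r) / lam"
      unfolding E_def d pt by (rule arith)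
    then show ?thesis
      using lam_gt_1 by (simp add: abs_mult)
  qed
  define B where "B = (b - c) * (lam / (lam - 1)) + (b - a)"
  have bound: "\<bar>E r\<bar> \<le> B" for r
  proof -
    have "\<bar>(b - c) * depth lam (shift r s)\<bar> \<le> (b - c) * (lam / (lam - 1))"
      unfolding abs_mult using depth_bounded[OF lam_gt_1, of "shift r s"] cb
      by (intro mult_mono) auto
    moreover have "\<bar>b - (f ^^ r) x\<bar> \<le> b - a"
      using iterate_in[OF assms(1), of r] by auto
    ultimately show ?thesis unfolding E_def B_def by linarith
  qed
  have "\<bar>E 0\<bar> = \<bar>E r\<bar> / lam ^ r" for r
  proof (induction r)
    case (Suc r)
    then show ?case using step[of r] by (simp add: divide_divide_eq_left)
  qed simp
  then have "\<bar>E 0\<bar> \<le> B * (1 / lam) ^ r" for r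
    using divide_right_mono[OF bound[of r], of "lam ^ r"] lam_gt_1
    by (simp add: power_one_over)
  moreover have "(\<lambda>r. B * (1 / lam) ^ r) \<longlonglongrightarrow> B * 0"
    using lam_gt_1 by (intro tendsto_mult_left LIMSEQ_realpow_zero) auto
  ultimately have "\<bar>E 0\<bar> \<le> 0"
    by (intro LIMSEQ_le_const[of "\<lambda>r. B * (1 / lam) ^ r" 0]) auto
  then show ?thesis by (simp add: E_def)
qed

lemma follows_shift: "follows x s \<Longrightarrow> follows ((f ^^ r) x) (shift r s)"
  unfolding follows_def shift_apply funpow_funpow by blast

lemma follows_depth_shift:
  assumes "x \<in> {a..b}" "follows x s"
  shows "(b - c) * depth lam (shift r s) = b - (f ^^ r) x"
  using follows_depth[OF iterate_in follows_shift] assms by blast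

lemma follows_depth_nonneg:
  assumes "x \<in> {a..b}" "follows x s"
  shows "0 \<le> depth lam (shift r s)"
proof -
  have "0 \<le> (b - c) * depth lam (shift r s)"
    using follows_depth_shift[OF assms, of r] iterate_in[OF assms(1), of r] by auto
  then show ?thesis using cb by (simp add: zero_le_mult_iff)
qed

lemma follows_mono:
  assumes x: "x \<in> {a..b}" "follows x s" and y: "y \<in> {a..b}" "follows y t"
    and "unimodal_less s t"
  shows "x \<le> y"
proof -
  obtain r where "depth lam s - depth lam t =
      (depth lam (shift (Suc r) s) + depth lam (shift (Suc r) t)) / lam ^ Suc r"
    using unimodal_less_depth[OF lam_gt_1 assms(5)] .
  then have "0 \<le> depth lam s - depth lam t"
    using follows_depth_nonneg[OF x, of "Suc r"] follows_depth_nonneg[OF y, of "Suc r"] lam_gt_1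
    by simp
  then have "0 \<le> (b - c) * (depth lam s - depth lam t)"
    using cb by simp
  also have "\<dots> = y - x"
    using follows_depth[OF x] follows_depth[OF y] by (simp add: algebra_simps)
  finally show ?thesis by simp
qed

lemma itinerary_follows:
  assumes "x \<in> {a..b}" "is_itinerary a b c f x s"
  shows "follows x s"
proof (cases "periodic f c")
  case True
  then have "s r = address a b c f ((f ^^ r) x)" for r
    using assms(2) by (auto simp: is_itinerary_def)
  then show ?thesis
    using iterate_in[OF assms(1)] ac cb unfolding follows_def address_def
    by (smt (verit) atLeastAtMost_iff atLeastLessThan_iff greaterThanAtMost_iff zero_neq_one)
next
  case False
  then show ?thesis using assms(2) by (auto simp: is_itinerary_def follows_def)
qed

lemma itinerary_shift:
  assumes "is_itinerary a b c f x s"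
  shows "is_itinerary a b c f ((f ^^ k) x) (shift k s)"
  using assms unfolding is_itinerary_def shift_apply funpow_funpow by auto

lemma orbit_b: "(f ^^ r) b = (f ^^ Suc r) c"
  by (simp add: funpow_swap1 fc)

text \<open>
  If the turning point is not periodic, the orbit of its image \<open>b\<close> never meets it, so no symbol
  is ambiguous.
\<close>

lemma itinerary_b_unique:
  assumes "is_itinerary a b c f b s" "is_itinerary a b c f b t"
  shows "s = t"
proof (rule ext)
  fix r
  show "s r = t r"
  proof (cases "periodic f c")
    case False
    then have "(f ^^ r) b \<noteq> c"
      unfolding orbit_b periodic_def by fastforce
    then show ?thesis
      using assms False unfolding is_itinerary_def by (cases "s r"; cases "t r") force+
  qed (use assms in \<open>auto simp: is_itinerary_def\<close>)
qed

lemma off_turning_itinerary: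
  assumes "x \<in> {a..b}" "\<forall>r. (f ^^ r) x \<noteq> c"
  shows "is_itinerary a b c f x (\<lambda>r. if (f ^^ r) x < c then 0 else 1)"
  using iterate_in[OF assms(1)] assms(2) unfolding is_itinerary_def address_def
  by (fastforce simp: less_le not_le)

lemma itinerary_K: "is_itinerary a b c f b K"
proof -
  have "\<exists>s. is_itinerary a b c f b s"
  proof (cases "periodic f c")
    case True
    then show ?thesis by (auto simp: is_itinerary_def)
  next
    case False
    then have "\<forall>r. (f ^^ r) b \<noteq> c"
      unfolding orbit_b periodic_def by fastforce
    then show ?thesis
      using off_turning_itinerary[of b] ac cb by auto
  qed
  then show ?thesis
    unfolding kneading_def using itinerary_b_unique by (metis theI)
qed

lemma b_in: "b \<in> {a..b}"
  using ac cb by simp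

lemmas follows_K = itinerary_follows[OF b_in itinerary_K]

text \<open>
  Points follow the unimodal order, and \<open>b\<close> is the rightmost point. Equality of points has to be
  treated separately, as monotonicity alone says nothing about two itineraries of \<open>b\<close>.
\<close>

lemma itinerary_le_K:
  assumes "x \<in> {a..b}" "is_itinerary a b c f x s"
  shows "unimodal_le s K"
proof (cases "x = b")
  case True
  then show ?thesis
    using itinerary_b_unique[OF _ itinerary_K, of s] assms by simp
next
  case False
  then have "\<not> unimodal_less K s"
    using follows_mono[OF b_in follows_K assms(1) itinerary_follows[OF assms]] assms(1) by auto
  then show ?thesis by (simp add: unimodal_le_iff)
qed

lemma shift_K_le: "unimodal_le (shift r K) K"
  by (rule itinerary_le_K[OF iterate_in[OF b_in] itinerary_shift[OF itinerary_K]])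

lemma K_0: "K 0 = 1"
proof -
  have "K 0 \<noteq> 0"
    using follows_K cb unfolding follows_def by (metis atLeastAtMost_iff funpow_0 not_le)
  then show ?thesis by simp
qed

lemma K_1: "K 1 = 0"
proof -
  have "(f ^^ 1) b = a"
    using fb by simp
  then have "K 1 \<noteq> 1"
    using follows_K ac unfolding follows_def by (metis atLeastAtMost_iff not_le)
  then show ?thesis by simp
qed

lemma f_increase: "x \<in> {a..c} \<Longrightarrow> x + (f a - a) \<le> f x"
proof -
  assume x: "x \<in> {a..c}"
  have "f x - x - (f a - a) = (lam - 1) * (x - a)"
    using f_left[OF x] f_left[of a] ac by (simp add: algebra_simps)
  also have "\<dots> \<ge> 0"
    using lam_gt_1 x by simp
  finally show ?thesis by simp
qed

lemma f_a: "f a = c + (1 + lam - lam\<^sup>2) * (b - c)"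
proof -
  have "c - a = (lam - 1) * (b - c)"
    using length_eq by (simp add: algebra_simps)
  then have "f a = b - lam * ((lam - 1) * (b - c))"
    using f_left[of a] ac by simp
  then show ?thesis
    by (simp add: algebra_simps power2_eq_square)
qed

text \<open>
  For slope \<open>2\<close> the endpoint \<open>a\<close> would be fixed, and its orbit would stay to the left of \<open>c\<close>.
\<close>

lemma f_a_gt: "a < f a"
proof -
  have "f a - a = lam * (2 - lam) * (b - c)"
    using f_a length_eq by (simp add: algebra_simps power2_eq_square)
  moreover have "0 < lam * (2 - lam) * (b - c)"
    using lam_gt_1 lam_lt cb by simp
  ultimately show ?thesis by linarith
qed

text \<open>
  To the left of the turning point every step moves the point right by at least \<open>f a - a\<close>. The
  bound \<open>N\<close> is uniform in \<open>x\<close>, so that it also limits how long a backward orbit can have stayed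
  on the left.
\<close>

lemma escape_left: "\<exists>N. \<forall>x\<in>{a..b}. \<exists>i<N. c < (f ^^ i) x"
proof -
  obtain N :: nat where N: "b - a < real N * (f a - a)"
    using f_a_gt reals_Archimedean3[of "f a - a"] by auto
  have "\<exists>i<N. c < (f ^^ i) x" if x: "x \<in> {a..b}" for x
  proof (rule ccontr)
    assume *: "\<not> (\<exists>i<N. c < (f ^^ i) x)"
    have "x + real i * (f a - a) \<le> (f ^^ i) x" if "i \<le> N" for i
      using that
    proof (induction i)
      case (Suc i)
      then have "\<not> c < (f ^^ i) x"
        using * Suc_le_lessD by blast
      then have "(f ^^ i) x \<in> {a..c}"
        using iterate_in[OF x, of i] by auto
      then show ?case
        using f_increase[of "(f ^^ i) x"] Suc by (simp add: algebra_simps)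
    qed simp
    from this[of N] show False
      using N x iterate_in[OF x, of N] by auto
  qed
  then show ?thesis by blast
qed

lemma K_one_again: "\<exists>L\<ge>1. K L = 1"
proof -
  have "a \<in> {a..b}"
    using ac cb by simp
  then obtain i where i: "c < (f ^^ i) a"
    using escape_left by blast
  have "(f ^^ Suc i) b = (f ^^ i) a"
    by (simp add: funpow_swap1 fb)
  then have "K (Suc i) \<noteq> 0"
    using follows_K i unfolding follows_def by (metis atLeastAtMost_iff not_le)
  then show ?thesis by (intro exI[of _ "Suc i"]) auto
qed

text \<open>
  The constant sequence \<open>1\<close> is the itinerary of the fixed point \<open>p\<close> to the right of \<open>c\<close>, and the
  left side is the itinerary of \<open>f a\<close>. The slope exceeds \<open>sqrt 2\<close> precisely when \<open>f a < p\<close>. The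
  lemma is the symbolic form of height less than \<open>1 / 2\<close>.
\<close>

lemma shift_2_K_less: "unimodal_less (shift 2 K) (\<lambda>_. 1)"
proof -
  define p where "p = c + (b - c) / (1 + lam)"
  have p: "p \<in> {c..b}"
    using cb lam_gt_1 by (auto simp: p_def field_simps)
  have "p - c = (b - c) / (1 + lam)"
    by (simp add: p_def)
  then have pc: "(p - c) * (1 + lam) = b - c"
    using lam_gt_1 by simp
  have fp: "f p = p"
    using f_right[OF p] pc by (simp add: algebra_simps)
  then have fpr: "(f ^^ r) p = p" for r
    by (induction r) auto
  have p': "p \<in> {a..b}"
    using p ac by simp
  have fol_p: "follows p (\<lambda>_. 1)"
    using fpr p by (simp add: follows_def)
  have fol_a: "follows (f a) (shift 2 K)"
    using follows_shift[OF follows_K, of 2] by (simp add: fb numeral_2_eq_2)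
  have fa: "f a \<in> {a..b}"
    using f_in ac cb by simp
  have "(1 + lam - lam\<^sup>2) * (1 + lam) < 1"
  proof -
    have "2 < lam\<^sup>2"
      using lam_gt real_less_rsqrt real_sqrt_less_iff lam_gt_1
      by (smt (verit) real_sqrt_abs real_sqrt_less_mono)
    then have "lam * 2 < lam * lam\<^sup>2"
      using lam_gt_1 by simp
    then show ?thesis
      by (simp add: algebra_simps power2_eq_square)
  qed
  then have "(1 + lam - lam\<^sup>2) * (1 + lam) * (b - c) < 1 * (b - c)"
    using cb by (intro mult_strict_right_mono) auto
  moreover have "f a - c = (1 + lam - lam\<^sup>2) * (b - c)"
    using f_a by simp
  ultimately have "(f a - c) * (1 + lam) < (p - c) * (1 + lam)"
    unfolding pc by (simp add: mult_ac)
  then have less: "f a < p"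
    using lam_gt_1 by (simp add: mult_less_cancel_right)
  have "shift 2 K \<noteq> (\<lambda>_. 1)"
    using follows_depth[OF p' fol_p] follows_depth[OF fa fol_a] less by auto
  moreover have "\<not> unimodal_less (\<lambda>_. 1) (shift 2 K)"
    using follows_mono[OF p' fol_p fa fol_a] less by auto
  ultimately show ?thesis
    using unimodal_linear by blast
qed

text \<open>
  If \<open>b\<close> returns to itself, then \<open>c\<close> is periodic, and the symbol given to \<open>c\<close> is chosen so that
  one period of the kneading sequence contains an even number of ones.
\<close>

lemma even_ones_period:
  assumes "(f ^^ n) b = b" "1 \<le> n"
  shows "even (ones K n)"
proof -
  have "Suc (n - 1) = n"
    using assms by simp
  then have "f ((f ^^ (n - 1)) b) = b"
    using assms(1) funpow.simps(2)[of "n - 1" f] by (simp only: o_apply)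
  then have "(f ^^ (n - 1)) b = c"
    using only_preimage iterate_in[OF b_in] by blast
  then have fnc: "(f ^^ n) c = c"
    using orbit_b[of "n - 1"] assms(2) by simp
  then have per: "periodic f c"
    using assms(2) by (auto simp: periodic_def)
  define N where "N = period f c"
  have N: "1 \<le> N" "(f ^^ N) c = c"
    using LeastI_ex[of "\<lambda>n. n \<ge> 1 \<and> (f ^^ n) c = c"] per
    unfolding N_def period_def periodic_def by auto
  have least: "N \<le> k" if "1 \<le> k" "(f ^^ k) c = c" for k
    unfolding N_def period_def by (rule Least_le) (use that in auto)
  have "(f ^^ (n mod N)) c = c"
    using funpow_mod_eq[OF N(2), of n] fnc by simp
  moreover have "n mod N < N"
    using N(1) by simp
  ultimately have "n mod N = 0"
    using least[of "n mod N"] by linarith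
  then obtain d where d: "n = d * N"
    by (metis dvd_div_mult_self mod_eq_0_iff_dvd)
  have K: "K r = address a b c f ((f ^^ r) b)" for r
    using itinerary_K per by (auto simp: is_itinerary_def)
  have "(f ^^ N) b = b"
    using N by (metis fc funpow_swap1)
  then have "K (r + N) = K r" for r
    unfolding K by (simp add: funpow_add)
  then have "ones K n = d * ones K N"
    using ones_periodic d by blast
  moreover have "even (ones K N)"
  proof -
    define M where "M = N - 1"
    have NM: "N = Suc M"
      using N by (simp add: M_def)
    have last: "K M = turning_symbol b c f"
      using K[of M] orbit_b[of M] N(2) ac cb unfolding NM address_def by simp
    have one: "K r = 1 \<longleftrightarrow> (f ^^ Suc r) c \<in> {c<..b}" if "r < M" for r
    proof -
      have "(f ^^ r) b \<noteq> c"
        using least[of "Suc r"] that orbit_b[of r] NM by auto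
      then show ?thesis
        using K[of r] iterate_in[OF b_in, of r] orbit_b[of r] unfolding address_def by auto
    qed
    have "{r. 1 \<le> r \<and> r < N \<and> (f ^^ r) c \<in> {c<..b}} = Suc ` {r. r < M \<and> K r = 1}"
    proof (intro equalityI subsetI)
      fix r assume r: "r \<in> {r. 1 \<le> r \<and> r < N \<and> (f ^^ r) c \<in> {c<..b}}"
      then show "r \<in> Suc ` {r. r < M \<and> K r = 1}"
        using one[of "r - 1"] NM by (intro image_eqI[of _ _ "r - 1"]) auto
    next
      fix r assume "r \<in> Suc ` {r. r < M \<and> K r = 1}"
      then show "r \<in> {r. 1 \<le> r \<and> r < N \<and> (f ^^ r) c \<in> {c<..b}}"
        using one NM by auto
    qed
    then have "card {r. 1 \<le> r \<and> r < N \<and> (f ^^ r) c \<in> {c<..b}} = ones K M"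
      by (simp add: card_image ones_card)
    then have "K M = (if even (ones K M) then 0 else 1)"
      using last by (simp add: turning_symbol_def N_def)
    then show ?thesis
      unfolding NM by (auto simp: ones_Suc)
  qed
  ultimately show ?thesis by simp
qed

text \<open>
  A finite set that contains every point which reaches \<open>c\<close> in exactly \<open>r\<close> steps; the two maps
  are the inverse branches of the tent map.
\<close>

primrec preturning :: "nat \<Rightarrow> real set" where
  "preturning 0 = {c}"
| "preturning (Suc r) =
     (\<lambda>y. c - (b - y) / lam) ` preturning r \<union> (\<lambda>y. c + (b - y) / lam) ` preturning r"

lemma preturning:
  assumes "x \<in> {a..b}" "(f ^^ r) x = c"
  shows "x \<in> preturning r"
  using assms
proof (induction r arbitrary: x)
  case (Suc r)
  have "f x \<in> preturning r"
    using Suc.IH[of "f x"] Suc.prems f_in by (simp add: funpow_swap1)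
  moreover have "x = c - (b - f x) / lam \<or> x = c + (b - f x) / lam"
    using f_left[of x] f_right[of x] Suc.prems lam_gt_1 by (cases "x \<le> c") auto
  ultimately show ?case by auto
qed auto

text \<open>
  Only countably many points ever reach the turning point.
\<close>

lemma off_turning_point:
  assumes "y < b"
  obtains x where "y < x" "x < b" "x \<in> {a..b}" "\<forall>r. (f ^^ r) x \<noteq> c"
proof -
  have "finite (preturning r)" for r
    by (induction r) auto
  then have "countable (\<Union>r. preturning r)"
    by (simp add: countable_finite)
  then have "\<not> {max y c<..<b} \<subseteq> (\<Union>r. preturning r)"
    using uncountable_open_interval[of "max y c" b] assms cb countable_subset by auto
  then obtain x where "x \<in> {max y c<..<b}" and x_not: "x \<notin> (\<Union>r. preturning r)"
    by blast
  then have x: "max y c < x" "x < b"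
    by auto
  have "x \<in> {a..b}"
    using x ac by auto
  moreover have "\<forall>r. (f ^^ r) x \<noteq> c"
    using preturning[OF \<open>x \<in> {a..b}\<close>] x_not by blast
  ultimately show ?thesis
    using that[of x] x by auto
qed

lemma inverse_limit_iterate:
  assumes "X \<in> inverse_limit a b f"
  shows "(f ^^ r) (X i) = X (i + int r)"
proof (induction r)
  case (Suc r)
  then show ?case
    using assms by (simp add: inverse_limit_def add.assoc[symmetric] add.commute[of 1])
qed simp

lemma biitinerary_tail:
  assumes "X \<in> inverse_limit a b f" "is_biitinerary a b c f X S"
  shows "is_itinerary a b c f (X i) (tail i S)"
  using assms(2) inverse_limit_iterate[OF assms(1)]
  unfolding is_biitinerary_def is_itinerary_def tail_def by auto

lemma biitineraries_tail_le:
  assumes "S \<in> biitineraries a b c f"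
  shows "unimodal_le (tail i S) K"
  using assms biitinerary_tail itinerary_le_K
  unfolding biitineraries_def inverse_limit_def by blast

text \<open>
  Otherwise the backward orbit would consist of points to the left of \<open>c\<close> from some time on,
  against the uniform escape bound.
\<close>

lemma biitineraries_one_left:
  assumes "S \<in> biitineraries a b c f"
  shows "\<exists>j<i. S j = 1"
proof -
  obtain X where X: "X \<in> inverse_limit a b f" "is_biitinerary a b c f X S"
    using assms by (auto simp: biitineraries_def)
  obtain N where N: "\<forall>x\<in>{a..b}. \<exists>i<N. c < (f ^^ i) x"
    using escape_left by blast
  have "X (i - int N) \<in> {a..b}"
    using X by (auto simp: inverse_limit_def)
  then obtain k where k: "k < N" "c < (f ^^ k) (X (i - int N))"
    using N by blast
  have "follows (X (i - int N)) (tail (i - int N) S)"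
    by (intro itinerary_follows biitinerary_tail X) (use \<open>X (i - int N) \<in> {a..b}\<close> in auto)
  then have "tail (i - int N) S k \<noteq> 0"
    using k unfolding follows_def by (metis atLeastAtMost_iff not_le)
  then show ?thesis
    using k by (intro exI[of _ "i - int N + int k"]) (auto simp: tail_def)
qed

lemma depth_K: "depth lam K = 0"
  using follows_depth[OF b_in follows_K] cb by simp

text \<open>
  Let \<open>- B\<close> be a common lower bound for the depths of all tails. Compare a tail with the
  kneading sequence, whose shifts have nonnegative depths: unless the two are equal, the depth
  of the tail is nonnegative or at least \<open>1 / lam\<close> times the depth of a later tail. So the lower
  bound improves to \<open>- B / lam\<close>, and by repetition to \<open>0\<close>.
\<close>

lemma tail_depth_nonneg:
  assumes "\<And>i. unimodal_le (tail i S) K"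
  shows "0 \<le> depth lam (tail i S)"
proof -
  define B where "B = lam / (lam - 1)"
  have B: "0 \<le> B"
    using lam_gt_1 by (simp add: B_def)
  have bound: "- B / lam ^ j \<le> depth lam (tail i S)" for i j
  proof (induction j arbitrary: i)
    case 0
    then show ?case
      using depth_bounded[OF lam_gt_1, of "tail i S"] by (simp add: B_def)
  next
    case (Suc j)
    show ?case
    proof (cases "tail i S = K")
      case True
      then show ?thesis
        using depth_K B lam_gt_1 by simp
    next
      case False
      then have "unimodal_less (tail i S) K"
        using assms[of i] by (simp add: unimodal_le_def)
      then obtain r where "depth lam (tail i S) - depth lam K =
          (depth lam (shift (Suc r) (tail i S)) + depth lam (shift (Suc r) K)) / lam ^ Suc r"
        using unimodal_less_depth[OF lam_gt_1] by blast
      then have "depth lam (tail i S) =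
          (depth lam (tail (i + int (Suc r)) S) + depth lam (shift (Suc r) K)) / lam ^ Suc r"
        by (simp add: depth_K)
      also have "\<dots> \<ge> (- B / lam ^ j) / lam ^ Suc r"
        using Suc[of "i + int (Suc r)"] follows_depth_nonneg[OF b_in follows_K, of "Suc r"] lam_gt_1
        by (intro divide_right_mono) auto
      also have "(- B / lam ^ j) / lam ^ Suc r \<ge> - B / lam ^ Suc j"
      proof -
        have "lam ^ j * lam ^ 1 \<le> lam ^ j * lam ^ Suc r"
          using lam_gt_1 by (intro mult_left_mono power_increasing) auto
        then have "B / (lam ^ j * lam ^ Suc r) \<le> B / (lam ^ j * lam ^ 1)"
          using B lam_gt_1 by (intro divide_left_mono) auto
        then show ?thesis
          by (simp add: mult.commute)
      qed
      finally show ?thesis .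
    qed
  qed
  have "(\<lambda>j. - B * (1 / lam) ^ j) \<longlonglongrightarrow> - B * 0"
    using lam_gt_1 by (intro tendsto_mult_left LIMSEQ_realpow_zero) auto
  then show ?thesis
    using bound[of _ i] by (intro LIMSEQ_le_const2[of "\<lambda>j. - B * (1 / lam) ^ j" 0])
      (auto simp: power_one_over)
qed

text \<open>
  The recursion of the depth is the inverse of the tent map, so the points defined by the depths
  form an orbit as soon as they lie in \<open>[a, b]\<close> and on the side of \<open>c\<close> that the symbol requires.
  Nonnegative depth gives the side and the bound \<open>b\<close>. The bound \<open>a\<close> holds just after a symbol
  \<open>1\<close>, because the image of \<open>[c, b]\<close> is \<open>[a, b]\<close>, and persists under the map; this is why ones
  are needed arbitrarily far to the left.
\<close>

lemma realize:
  assumes le: "\<And>i. unimodal_le (tail i S) K" and one: "\<And>i. \<exists>j<i. S j = 1"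
  defines "X \<equiv> \<lambda>i. b - (b - c) * depth lam (tail i S)"
  shows "X \<in> inverse_limit a b f" "S i = 0 \<Longrightarrow> X i \<in> {a..c}" "S i = 1 \<Longrightarrow> X i \<in> {c..b}"
proof -
  let ?D = "\<lambda>i. depth lam (tail i S)"
  have nn: "0 \<le> ?D i" for i
    by (rule tail_depth_nonneg[OF le])
  have rec: "?D i = 1 + (if S i = 1 then -1 else 1) * ?D (i + 1) / lam" for i
    using depth_unfold[OF lam_gt_1, of "tail i S"] by simp
  have le_one_right: "?D (j + 1 + int k) \<le> lam" if "S j = 1" for j k
  proof (induction k)
    case 0
    then show ?case
      using nn[of j] rec[of j] that lam_gt_1 by (simp add: field_simps)
  next
    case (Suc k)
    let ?i = "j + 1 + int k"
    have i: "j + 1 + int (Suc k) = ?i + 1" by simp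
    show ?case
    proof (cases "S ?i = 1")
      case True
      then have "?D (?i + 1) / lam \<le> 1"
        using nn[of ?i] rec[of ?i] by simp
      then show ?thesis
        unfolding i using lam_gt_1 by (simp add: divide_le_eq)
    next
      case False
      then have "?D (?i + 1) = lam * (?D ?i - 1)"
        using rec[of ?i] lam_gt_1 by simp
      also have "\<dots> \<le> lam * (lam - 1)"
        using Suc lam_gt_1 by (intro mult_left_mono) auto
      also have "\<dots> \<le> lam * 1"
        using lam_gt_1 lam_lt by (intro mult_left_mono) auto
      finally show ?thesis unfolding i by simp
    qed
  qed
  have le_lam: "?D i \<le> lam" for i
  proof -
    obtain j where "j < i" "S j = 1"
      using one by blast
    then show ?thesis
      using le_one_right[of j "nat (i - j - 1)"] by simp
  qed
  have X: "X i \<in> {a..b}" for i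
  proof -
    have "(b - c) * ?D i \<le> (b - c) * lam"
      using le_lam[of i] cb by (intro mult_left_mono) auto
    moreover have "0 \<le> (b - c) * ?D i"
      using nn[of i] cb by simp
    ultimately show ?thesis
      using length_eq mult.commute[of lam "b - c"] unfolding X_def atLeastAtMost_iff by linarith
  qed
  have left: "X i \<in> {a..c}" if "S i = 0" for i
  proof -
    have "1 \<le> ?D i"
      using rec[of i] nn[of "i + 1"] that lam_gt_1 by simp
    then have "(b - c) * 1 \<le> (b - c) * ?D i"
      using cb by (intro mult_left_mono) auto
    then show ?thesis using X[of i] by (auto simp: X_def)
  qed
  have right: "X i \<in> {c..b}" if "S i = 1" for i
  proof -
    have "?D i \<le> 1"
      using rec[of i] nn[of "i + 1"] that lam_gt_1 by simp
    then have "(b - c) * ?D i \<le> (b - c) * 1"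
      using cb by (intro mult_left_mono) auto
    then show ?thesis using X[of i] by (auto simp: X_def)
  qed
  show "S i = 0 \<Longrightarrow> X i \<in> {a..c}" "S i = 1 \<Longrightarrow> X i \<in> {c..b}"
    using left right by auto
  have "f (X i) = X (i + 1)" for i
  proof (cases "S i = 1")
    case True
    have "f (X i) = b - lam * ((b - c) * (1 - ?D i))"
      using f_right[OF right[OF True]] by (simp add: X_def algebra_simps)
    also have "1 - ?D i = ?D (i + 1) / lam"
      using rec[of i] True by simp
    finally show ?thesis
      using lam_gt_1 by (simp add: X_def)
  next
    case False
    then have "S i = 0" by simp
    have "f (X i) = b - lam * ((b - c) * (?D i - 1))"
      using f_left[OF left[OF \<open>S i = 0\<close>]] by (simp add: X_def algebra_simps)
    also have "?D i - 1 = ?D (i + 1) / lam"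
      using rec[of i] False by simp
    finally show ?thesis
      using lam_gt_1 by (simp add: X_def)
  qed
  then show "X \<in> inverse_limit a b f"
    using X by (auto simp: inverse_limit_def)
qed

text \<open>
  If \<open>c\<close> is periodic, its symbol is prescribed, and an orbit through \<open>c\<close> could carry the wrong
  one. Passing through \<open>c\<close> once would mean doing so again and again, also after time \<open>i\<close>, where
  the orbit is that of \<open>x\<close>.
\<close>

lemma biitineraries_intro:
  assumes le: "\<And>i. unimodal_le (tail i S) K" and one: "\<And>i. \<exists>j<i. S j = 1"
    and x: "x \<in> {a..b}" "\<forall>r. (f ^^ r) x \<noteq> c" "is_itinerary a b c f x (tail i S)"
  shows "S \<in> biitineraries a b c f"
proof -
  define X where "X = (\<lambda>i. b - (b - c) * depth lam (tail i S))"
  have X: "X \<in> inverse_limit a b f" "S i = 0 \<Longrightarrow> X i \<in> {a..c}" "S i = 1 \<Longrightarrow> X i \<in> {c..b}" for i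
    using realize[OF le one] unfolding X_def by blast+
  have "is_biitinerary a b c f X S"
  proof (cases "periodic f c")
    case True
    then obtain N where N: "1 \<le> N" "(f ^^ N) c = c"
      by (auto simp: periodic_def)
    have "X i = x"
      using follows_depth[OF x(1) itinerary_follows[OF x(1,3)]] by (simp add: X_def)
    have "X j \<noteq> c" for j
    proof
      assume "X j = c"
      define k where "k = nat \<bar>i - j\<bar>"
      have "j + int (k * N) \<ge> i"
      proof -
        have "int k * 1 \<le> int k * int N"
          using N by (intro mult_left_mono) auto
        then show ?thesis by (simp add: k_def)
      qed
      then obtain m where m: "j + int (k * N) = i + int m"
        by (metis zle_iff_zadd)
      have "(f ^^ (k * N)) c = c"
        using N(2) by (induction k) (auto simp: funpow_add)
      then have "X (j + int (k * N)) = c"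
        using inverse_limit_iterate[OF X(1), of "k * N" j] \<open>X j = c\<close> by simp
      then have "(f ^^ m) x = c"
        using inverse_limit_iterate[OF X(1), of m i] m \<open>X i = x\<close> by simp
      then show False using x(2) by blast
    qed
    then have "S j = address a b c f (X j)" for j
      using X(2,3)[of j] by (cases "S j") (force simp: address_def)+
    then show ?thesis
      using True by (auto simp: is_biitinerary_def)
  next
    case False
    then show ?thesis
      using X(2,3) by (auto simp: is_biitinerary_def)
  qed
  then show ?thesis
    using X(1) by (auto simp: biitineraries_def)
qed

end

section \<open>The words of rational slopes\<close>

lemma rat_numer_denom:
  assumes "0 < q"
  shows "1 \<le> numer q" "1 \<le> denom q" "coprime (numer q) (denom q)"
    "real_of_rat q = real (numer q) / real (denom q)"
proof -
  obtain p d where pd: "quotient_of q = (p, d)"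
    by (cases "quotient_of q")
  have d: "0 < d" and cop: "coprime p d" and q: "q = of_int p / of_int d"
    using quotient_of_denom_pos[OF pd] quotient_of_coprime[OF pd] quotient_of_div[OF pd] by auto
  have "numer q = nat p" "denom q = nat d"
    using pd by (auto simp: numer_def denom_def)
  moreover have p: "0 < p"
    using assms q d by (simp add: zero_less_divide_iff)
  ultimately have n: "p = int (numer q)" "d = int (denom q)"
    using d by simp_all
  show "1 \<le> numer q" "1 \<le> denom q"
    using p d unfolding n by linarith+
  show "coprime (numer q) (denom q)"
    using cop unfolding n coprime_int_iff .
  show "real_of_rat q = real (numer q) / real (denom q)"
    using arg_cong[OF q, of real_of_rat] unfolding n by (simp add: of_rat_divide)
qed

lemma div_add_le: "(x :: nat) div m + y div m \<le> (x + y) div m"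
  using div_add1_eq[of x y m] by linarith

lemma div_add_ge: "0 < m \<Longrightarrow> (x + y) div m \<le> x div m + y div m + (1 :: nat)"
proof -
  assume m: "0 < m"
  have "(x mod m + y mod m) div m < 2"
    unfolding div_less_iff_less_mult[OF m]
    using mod_less_divisor[OF m, of x] mod_less_divisor[OF m, of y] by linarith
  then show ?thesis using div_add1_eq[of x y m] by linarith
qed

lemma div_pred:
  assumes "1 \<le> (x :: nat)"
  shows "(x - 1) div d = (if d dvd x then x div d - 1 else x div d)"
proof -
  obtain y where "x = Suc y"
    using assms by (cases x) auto
  then show ?thesis
    using div_Suc[of y d] by (auto simp: dvd_eq_mod_eq_0)
qed

text \<open>
  The last vertical line \<open>x = integer\<close> that the line \<open>y = q x\<close> meets at height at most \<open>j\<close>; as a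
  formula, \<open>\<lfloor>j / q\<rfloor>\<close>.
\<close>

definition cross :: "rat \<Rightarrow> nat \<Rightarrow> nat" where
  "cross q j = j * denom q div numer q"

text \<open>
  For \<open>j \<ge> 1\<close>, the largest integer strictly less than \<open>j / q\<close>. It differs from \<open>cross q j\<close> only
  at the multiples of the numerator, where the line passes through a lattice point, and it is
  the value that \<open>cross\<close> takes at slopes slightly greater than \<open>q\<close>.
\<close>

definition cross_left :: "rat \<Rightarrow> nat \<Rightarrow> nat" where
  "cross_left q j = (j * denom q - 1) div numer q"

text \<open>
  The bound \<open>1 / 2\<close> makes consecutive crossings differ by at least \<open>2\<close>, so that the pairs of
  ones do not overlap.
\<close>

locale low_height =
  fixes q :: rat
  assumes q_pos: "0 < q" and q_half: "q \<le> 1 / 2"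
begin

abbreviation m :: nat where "m \<equiv> numer q"
abbreviation n :: nat where "n \<equiv> denom q"

lemmas m_pos = rat_numer_denom(1)[OF q_pos]
lemmas n_pos = rat_numer_denom(2)[OF q_pos]
lemmas coprime_mn = rat_numer_denom(3)[OF q_pos]
lemmas of_q = rat_numer_denom(4)[OF q_pos]

lemma two_m: "2 * m \<le> n"
proof -
  have "real_of_rat q \<le> real_of_rat (1 / 2)"
    using q_half by (simp add: of_rat_less_eq)
  then have "real m / real n \<le> 1 / 2"
    using of_q by (simp add: of_rat_divide)
  then have "2 * real m \<le> real n"
    using n_pos by (simp add: divide_le_eq)
  then show ?thesis by linarith
qed

lemma cross_0 [simp]: "cross q 0 = 0" and cross_m [simp]: "cross q m = n"
  using m_pos by (auto simp: cross_def)

lemma cross_add_le: "cross q i + cross q j \<le> cross q (i + j)"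
  unfolding cross_def add_mult_distrib by (rule div_add_le)

lemma cross_add_ge: "cross q (i + j) \<le> cross q i + cross q j + 1"
  unfolding cross_def add_mult_distrib using m_pos by (intro div_add_ge) auto

lemma cross_1: "2 \<le> cross q 1"
  using two_m m_pos by (simp add: cross_def less_eq_div_iff_mult_less_eq)

lemma cross_Suc: "cross q j + 2 \<le> cross q (Suc j)"
  using cross_add_le[of j 1] cross_1 by simp

lemma cross_spaced: "spaced (cross q) k"
  using cross_1 cross_Suc by (auto simp: spaced_def)

lemma cross_less: "i < j \<Longrightarrow> cross q i + 2 \<le> cross q j"
proof (induction j)
  case (Suc j)
  then show ?case using cross_Suc[of j] by (cases "i = j") (auto simp: less_Suc_eq)
qed auto

lemma cross_add_m: "cross q (j + m) = cross q j + n"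
  using m_pos by (simp add: cross_def add_mult_distrib)

lemma cross_add_mult: "cross q (j + k * m) = cross q j + k * n"
  using m_pos by (simp add: cross_def add_mult_distrib mult.assoc mult.left_commute[of k])

lemma not_dvd: "1 \<le> j \<Longrightarrow> j < m \<Longrightarrow> \<not> m dvd j * n"
  using coprime_mn by (metis coprime_dvd_mult_left_iff dvd_imp_le not_le less_le_trans zero_less_one)

text \<open>
  As \<open>j * n\<close> is not divisible by \<open>m\<close>, the remainders of \<open>j * n\<close> and \<open>(m - j) * n\<close> add up to \<open>m\<close>.
  This is the symmetry of the segment from the origin to \<open>(n, m)\<close> under rotation by a half turn,
  and the reason why \<open>c_word q\<close> is a palindrome.
\<close>

lemma cross_reflect:
  assumes "1 \<le> j" "j < m"
  shows "cross q (m - j) + cross q j + 1 = n"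
proof -
  let ?x = "j * n"
  have md: "?x mod m \<noteq> 0"
    using not_dvd[OF assms] by (simp add: dvd_eq_mod_eq_0)
  have "(m - j) * n + ?x = n * m"
    using assms by (simp add: algebra_simps diff_mult_distrib)
  then have "((m - j) * n + ?x) div m = n" "((m - j) * n + ?x) mod m = 0"
    using m_pos by auto
  moreover have "(((m - j) * n) mod m + ?x mod m) div m = 1"
  proof -
    have "(((m - j) * n) mod m + ?x mod m) mod m = 0"
      using \<open>((m - j) * n + ?x) mod m = 0\<close> by (simp add: mod_add_eq)
    then have "m dvd ((m - j) * n) mod m + ?x mod m"
      by auto
    then obtain k where k: "((m - j) * n) mod m + ?x mod m = m * k"
      by (rule dvdE)
    have "((m - j) * n) mod m < m" "?x mod m < m"
      using m_pos by auto
    then have "m * k < m * 2" "0 < m * k"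
      using k md by linarith+
    then have "k = 1"
      by auto
    then show ?thesis
      using k m_pos by simp
  qed
  ultimately show ?thesis
    unfolding cross_def using div_add1_eq[of "(m - j) * n" ?x m] by linarith
qed

text \<open>
  The strip between heights \<open>i\<close> and \<open>i + 1\<close> contains the crossings with \<open>x\<close> from \<open>cross q i + 1\<close>
  to \<open>cross q (i + 1)\<close>. The first strip has one more, at the origin, since there the lower end
  is itself a lattice point.
\<close>

lemma line_count_1: "line_count (of_rat q) 1 + 2 = cross q 1 + 1"
  and line_count_Suc: "1 \<le> i \<Longrightarrow> i < m \<Longrightarrow> line_count (of_rat q) (Suc i) + 2 = cross q (Suc i) - cross q i"
proof -
  have iff: "real_of_rat q * of_int j \<in> {real (Suc i) - 1..real (Suc i)} \<longleftrightarrow>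
      int (i * n) \<le> int m * j \<and> int m * j \<le> int (Suc i * n)" for i and j :: int
  proof -
    have "real_of_rat q * of_int j = of_int (int m * j) / real n"
      using of_q by simp
    then have "real_of_rat q * of_int j \<in> {real (Suc i) - 1..real (Suc i)} \<longleftrightarrow>
        of_int (int (i * n)) \<le> (of_int (int m * j) :: real) \<and>
        (of_int (int m * j) :: real) \<le> of_int (int (Suc i * n))"
      using n_pos by (simp add: pos_le_divide_eq pos_divide_le_eq ring_distribs)
    then show ?thesis
      unfolding of_int_le_iff .
  qed
  have up: "int m * j \<le> int (i * n) \<longleftrightarrow> j \<le> int (cross q i)" for i and j :: int
  proof
    assume "int m * j \<le> int (i * n)"
    then have "int m * j div int m \<le> int (i * n) div int m"
      using m_pos by (intro zdiv_mono1) auto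
    then show "j \<le> int (cross q i)"
      using m_pos unfolding cross_def zdiv_int by simp
  next
    assume "j \<le> int (cross q i)"
    then have "int m * j \<le> int m * int (cross q i)"
      by (intro mult_left_mono) auto
    also have "\<dots> \<le> int (i * n)"
      unfolding cross_def of_nat_mult[symmetric] of_nat_le_iff by simp
    finally show "int m * j \<le> int (i * n)" .
  qed
  have down0: "0 \<le> int m * j \<longleftrightarrow> 0 \<le> j" for j :: int
    using m_pos by (simp add: zero_le_mult_iff)
  have "{j::int. real_of_rat q * of_int j \<in> {real 1 - 1..real 1}} = {0..int (cross q 1)}"
    using iff[of _ 0] up[of _ 1] down0 by auto
  then show "line_count (of_rat q) 1 + 2 = cross q 1 + 1"
    using cross_1 unfolding line_count_def by simp
  assume i: "1 \<le> i" "i < m"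
  have down: "int (i * n) \<le> int m * j \<longleftrightarrow> int (cross q i) + 1 \<le> j" for j :: int
  proof -
    have "int (i * n) \<noteq> int m * j"
    proof
      assume "int (i * n) = int m * j"
      then have "int m dvd int (i * n)" by simp
      then have "m dvd i * n" by (simp only: int_dvd_int_iff)
      then show False using not_dvd[OF i] by blast
    qed
    then have "int (i * n) \<le> int m * j \<longleftrightarrow> \<not> int m * j \<le> int (i * n)"
      by linarith
    then show ?thesis unfolding up by auto
  qed
  have "{j::int. real_of_rat q * of_int j \<in> {real (Suc i) - 1..real (Suc i)}} =
      {int (cross q i) + 1..int (cross q (Suc i))}"
    unfolding iff down up by auto
  then show "line_count (of_rat q) (Suc i) + 2 = cross q (Suc i) - cross q i"
    using cross_Suc[of i] unfolding line_count_def by (simp add: nat_diff_distrib')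
qed

lemma cross_le: "i \<le> j \<Longrightarrow> cross q i \<le> cross q j"
  using cross_less[of i j] by (cases "i = j") auto

lemma pair_seq_gap:
  assumes "cross q j + 2 \<le> r" "r < cross q (Suc j)"
  shows "pair_seq (cross q) r = 0"
proof -
  have "r \<noteq> cross q i \<and> r \<noteq> Suc (cross q i)" for i
    using cross_le[of i j] cross_le[of "Suc j" i] assms by (cases "i \<le> j") auto
  then show ?thesis using assms by (auto simp: pair_seq_def)
qed

definition block :: "nat \<Rightarrow> bit list" where
  "block i = [1] @ replicate (line_count (of_rat q) i) 0 @ [1]"

lemma block_nth:
  "r < length (block i) \<Longrightarrow> block i ! r = (if r = 0 \<or> Suc r = length (block i) then 1 else 0)"
  by (auto simp: block_def nth_append nth_Cons split: nat.splits)

text \<open>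
  The \<open>i\<close>-th factor has length \<open>cross q i - cross q (i - 1)\<close> for \<open>i \<ge> 2\<close>, so it ends at position
  \<open>cross q i\<close>. Its final \<open>1\<close> and the initial \<open>1\<close> of the next factor form a pair.
\<close>

lemma block_prefix:
  assumes "1 \<le> j" "j \<le> m"
  shows "length (concat (map block [1..<Suc j])) = Suc (cross q j) \<and>
    (\<forall>r\<le>cross q j. concat (map block [1..<Suc j]) ! r = pair_seq (cross q) r)"
  using assms
proof (induction j rule: dec_induct)
  case base
  have len: "length (block 1) = Suc (cross q 1)"
    using line_count_1 by (simp add: block_def)
  moreover have "block 1 ! r = pair_seq (cross q) r" if r: "r \<le> cross q 1" for r
  proof -
    consider "r = 0" | "r = cross q 1" | "0 < r" "r < cross q 1"
      using r by linarith
    then show ?thesis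
    proof cases
      case 1
      then show ?thesis using len by (simp add: block_nth pair_seq_def)
    next
      case 2
      then have "pair_seq (cross q) r = 1"
        unfolding pair_seq_1 by blast
      then show ?thesis using 2 len by (simp add: block_nth)
    next
      case 3
      then have "pair_seq (cross q) r = 0"
        using cross_le[of 1] by (force simp: pair_seq_def)
      then show ?thesis
        using 3 len by (simp add: block_nth)
    qed
  qed
  ultimately show ?case
    by simp
next
  case (step j)
  let ?w = "concat (map block [1..<Suc j])"
  have lw: "length ?w = Suc (cross q j)" and w: "\<forall>r\<le>cross q j. ?w ! r = pair_seq (cross q) r"
    using step by auto
  have lb: "length (block (Suc j)) = cross q (Suc j) - cross q j"
    using line_count_Suc[of j] step by (simp add: block_def)
  have split: "concat (map block [1..<Suc (Suc j)]) = ?w @ block (Suc j)"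
    using step by simp
  have "(?w @ block (Suc j)) ! r = pair_seq (cross q) r" if "r \<le> cross q (Suc j)" for r
  proof (cases "r \<le> cross q j")
    case True
    then show ?thesis using w lw by (simp add: nth_append)
  next
    case False
    define i where "i = r - Suc (cross q j)"
    have r: "r = Suc (cross q j) + i"
      using False by (simp add: i_def)
    have "(?w @ block (Suc j)) ! r = block (Suc j) ! i"
      using False lw by (simp add: nth_append i_def)
    also have "\<dots> = (if i = 0 \<or> r = cross q (Suc j) then 1 else 0)"
      using that lb block_nth[of i "Suc j"] unfolding r by auto
    also have "\<dots> = pair_seq (cross q) r"
    proof -
      consider "i = 0" | "r = cross q (Suc j)" | "i \<noteq> 0" "r \<noteq> cross q (Suc j)" by blast
      then show ?thesis
      proof cases
        case 1
        then have "pair_seq (cross q) r = 1"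
          using step(1) unfolding r pair_seq_1 by auto
        then show ?thesis using 1 by simp
      next
        case 2
        then have "pair_seq (cross q) r = 1"
          unfolding pair_seq_1 by (auto intro!: exI[of _ "Suc j"])
        then show ?thesis using 2 by simp
      next
        case 3
        then show ?thesis
          using pair_seq_gap[of j r] that by (simp add: r)
      qed
    qed
    finally show ?thesis .
  qed
  then show ?case
    unfolding split using lw lb cross_Suc[of j] by simp
qed

lemma c_word_length: "length (c_word q) = Suc n"
  and c_word_nth: "r \<le> n \<Longrightarrow> c_word q ! r = pair_seq (cross q) r"
proof -
  have "c_word q = concat (map block [1..<Suc m])"
    unfolding c_word_def block_def ..
  then show "length (c_word q) = Suc n" "r \<le> n \<Longrightarrow> c_word q ! r = pair_seq (cross q) r"
    using block_prefix[of m] m_pos by (simp_all del: upt_Suc)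
qed

text \<open>
  The positions of the pairs strictly inside one period. They are symmetric about \<open>n / 2\<close>; the
  pair at the end of the period is not, which is why it is left out.
\<close>

definition inner_pair :: "nat \<Rightarrow> bool" where
  "inner_pair r \<longleftrightarrow> (\<exists>j. 1 \<le> j \<and> j < m \<and> (r = cross q j \<or> r = Suc (cross q j)))"

lemma inner_pair_bounds: "inner_pair r \<Longrightarrow> 2 \<le> r \<and> r + 2 \<le> n"
proof -
  assume "inner_pair r"
  then obtain j where j: "1 \<le> j" "j < m" "r = cross q j \<or> r = Suc (cross q j)"
    by (auto simp: inner_pair_def)
  have "cross q 1 \<le> cross q j" "cross q 1 \<le> cross q (m - j)"
    using j by (auto intro: cross_le)
  then show ?thesis
    using cross_1 cross_reflect[OF j(1,2)] j(3) by linarith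
qed

lemma inner_pair_reflect: "inner_pair r \<Longrightarrow> inner_pair (n - r)"
proof -
  assume "inner_pair r"
  then obtain j where j: "1 \<le> j" "j < m" "r = cross q j \<or> r = Suc (cross q j)"
    by (auto simp: inner_pair_def)
  then have "n - r = Suc (cross q (m - j)) \<or> n - r = cross q (m - j)"
    using cross_reflect[OF j(1,2)] by auto
  then show ?thesis
    unfolding inner_pair_def using j by (intro exI[of _ "m - j"]) auto
qed

lemma inner_pair_reflect_iff: "r \<le> n \<Longrightarrow> inner_pair (n - r) \<longleftrightarrow> inner_pair r"
  using inner_pair_reflect[of r] inner_pair_reflect[of "n - r"] by auto

lemma n_ge_2: "2 \<le> n"
  using two_m m_pos by linarith

lemma cross_split: "\<exists>i k. j = i + k * m \<and> i < m \<and> cross q j = cross q i + k * n"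
  using m_pos cross_add_mult[of "j mod m" "j div m"] by (intro exI[of _ "j mod m"] exI[of _ "j div m"]) auto

text \<open>
  The index \<open>0\<close> is admitted here, so that the positions form a set of period \<open>n\<close>.
\<close>

lemma pair_position_mod:
  "(\<exists>j. r = cross q j \<or> r = Suc (cross q j)) \<longleftrightarrow> r mod n = 0 \<or> r mod n = 1 \<or> inner_pair (r mod n)"
proof
  assume "\<exists>j. r = cross q j \<or> r = Suc (cross q j)"
  then obtain j where j: "r = cross q j \<or> r = Suc (cross q j)" by blast
  obtain i k where ik: "i < m" "cross q j = cross q i + k * n"
    using cross_split[of j] by blast
  show "r mod n = 0 \<or> r mod n = 1 \<or> inner_pair (r mod n)"
  proof (cases "i = 0")
    case True
    then show ?thesis using j ik n_ge_2 by (auto simp: mod_Suc)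
  next
    case False
    then have "inner_pair (cross q i)" "inner_pair (Suc (cross q i))"
      using ik by (auto simp: inner_pair_def intro!: exI[of _ i])
    then have "r mod n = cross q i \<or> r mod n = Suc (cross q i)"
      using j ik inner_pair_bounds[of "Suc (cross q i)"] by (auto simp del: mult_Suc simp flip: add_Suc)
    then show ?thesis using \<open>inner_pair (cross q i)\<close> \<open>inner_pair (Suc (cross q i))\<close> by auto
  qed
next
  have shift: "cross q (i + (r div n) * m) = cross q i + (r div n) * n" for i
    by (rule cross_add_mult)
  assume "r mod n = 0 \<or> r mod n = 1 \<or> inner_pair (r mod n)"
  then have "\<exists>i. r mod n = cross q i \<or> r mod n = Suc (cross q i)"
    by (auto simp: inner_pair_def intro: exI[of _ 0])
  then obtain i where "r mod n = cross q i \<or> r mod n = Suc (cross q i)" by blast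
  then have "r = cross q (i + (r div n) * m) \<or> r = Suc (cross q (i + (r div n) * m))"
    unfolding shift using mod_div_mult_eq[of r n] by linarith
  then show "\<exists>j. r = cross q j \<or> r = Suc (cross q j)" by blast
qed

lemma pair_seq_mod:
  assumes "2 \<le> r"
  shows "pair_seq (cross q) r = 1 \<longleftrightarrow> r mod n = 0 \<or> r mod n = 1 \<or> inner_pair (r mod n)"
proof -
  have "1 \<le> j" if "r = cross q j \<or> r = Suc (cross q j)" for j
    using that assms by (cases j) auto
  then show ?thesis
    unfolding pair_position_mod[symmetric] pair_seq_1 using assms by auto
qed

lemma w_word_length: "length (w_word q) = n - 1"
  by (simp add: w_word_def c_word_length)

lemma w_word_nth: "r < n - 1 \<Longrightarrow> w_word q ! r = pair_seq (cross q) r"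
  by (simp add: w_word_def c_word_nth)

text \<open>
  Beyond \<open>c_word q\<close> both sides have period \<open>n\<close>. Reversing \<open>w_word q\<close> is harmless because of the
  symmetry of the interior pairs; the additional \<open>1\<close> is the second member of the pair at
  \<open>cross q m = n\<close>.
\<close>

lemma rhe_pair_seq: "rhe q = pair_seq (cross q)"
proof (rule ext)
  fix r
  show "rhe q r = pair_seq (cross q) r"
  proof (cases "r \<le> n")
    case True
    then show ?thesis
      by (simp add: rhe_def prepend_def c_word_length c_word_nth)
  next
    case False
    define i where "i = (r - Suc n) mod n"
    have i: "i < n"
      using n_pos by (simp add: i_def)
    have len: "length (1 # rev (w_word q)) = n"
      using w_word_length n_pos by simp
    have rhe: "rhe q r = (1 # rev (w_word q)) ! i"
      using False len by (simp add: rhe_def prepend_def c_word_length word_omega_def i_def)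
    have rn: "r = Suc (r - Suc n) + n"
      using False by simp
    have rmod: "r mod n = Suc i mod n"
      unfolding i_def mod_Suc_eq by (subst rn) (simp only: mod_add_self2)
    have "2 \<le> r"
      using False n_ge_2 by simp
    note iff = pair_seq_mod[OF this, unfolded rmod]
    consider "i = 0" | "Suc i = n" | "0 < i" "Suc i < n"
      using i by linarith
    then show ?thesis
    proof cases
      case 1
      then show ?thesis
        unfolding rhe using iff n_ge_2 by (auto intro!: bit_eqI)
    next
      case 2
      then have "(1 # rev (w_word q)) ! i = w_word q ! 0"
        using n_ge_2 w_word_length by (simp add: nth_Cons' rev_nth)
      also have "\<dots> = 1"
        using n_ge_2 by (simp add: w_word_nth pair_seq_def)
      finally show ?thesis
        unfolding rhe using iff 2 by (auto intro!: bit_eqI)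
    next
      case 3
      then have "(1 # rev (w_word q)) ! i = w_word q ! (n - Suc i)"
        using w_word_length by (simp add: nth_Cons' rev_nth)
      also have "\<dots> = pair_seq (cross q) (n - Suc i)"
        using 3 by (intro w_word_nth) auto
      finally have eq: "rhe q r = pair_seq (cross q) (n - Suc i)"
        unfolding rhe .
      have r1: "pair_seq (cross q) r = 1 \<longleftrightarrow> inner_pair (Suc i)"
        using iff 3 by simp
      have "pair_seq (cross q) (n - Suc i) = 1 \<longleftrightarrow> inner_pair (n - Suc i)"
      proof (cases "n - Suc i = 1")
        case True
        then show ?thesis
          using cross_le[of 1] cross_1 inner_pair_bounds[of 1]
          by (fastforce simp: pair_seq_1)
      next
        case False
        then show ?thesis
          using pair_seq_mod[of "n - Suc i"] 3 by simp
      qed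
      then show ?thesis
        unfolding eq using r1 inner_pair_reflect_iff[of "Suc i"] 3 by (intro bit_eqI) simp
    qed
  qed
qed

end

section \<open>Slopes close to a given one\<close>

lemma of_nat_divide_rat:
  assumes "0 < q'"
  shows "real j / real_of_rat q' = real (j * denom q') / real (numer q')"
  using rat_numer_denom[OF assms] by simp

lemma cross_eqI:
  assumes "0 < q'" "real C \<le> real j / real_of_rat q'" "real j / real_of_rat q' < real C + 1"
  shows "cross q' j = C"
proof -
  have "int (cross q' j) = \<lfloor>real j / real_of_rat q'\<rfloor>"
    unfolding of_nat_divide_rat[OF assms(1)] cross_def by (rule floor_divide_of_nat_eq[symmetric])
  also have "\<dots> = int C"
    using assms by (intro floor_unique) auto
  finally show ?thesis by simp
qed

text \<open>
  For \<open>j\<close> equal to the numerator, \<open>j / q'\<close> is an integer, so it cannot lie strictly between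
  consecutive integers. This guarantees that \<open>c_word q'\<close> is long when \<open>q'\<close> is close to, but
  different from, a given slope.
\<close>

lemma numer_gtI:
  assumes "0 < q'"
    and "\<And>j. 1 \<le> j \<Longrightarrow> j \<le> N \<Longrightarrow>
      real (C j) < real j / real_of_rat q' \<and> real j / real_of_rat q' < real (C j) + 1"
  shows "N < numer q'"
proof (rule ccontr)
  assume "\<not> N < numer q'"
  then have "real (C (numer q')) < real (denom q')" "real (denom q') < real (C (numer q')) + 1"
    using assms(2)[of "numer q'"] rat_numer_denom(1)[OF assms(1)] of_nat_divide_rat[OF assms(1)]
    by auto
  then have "real (C (numer q')) < real (denom q')" "real (denom q') < real (C (numer q') + 1)"
    by simp_all
  then show False
    unfolding of_nat_less_iff by simp
qed

context low_height
begin

lemma of_q_pos: "0 < real_of_rat q"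
  using q_pos by simp

lemma divide_tendsto: "((\<lambda>x. real j / x) \<longlongrightarrow> real j / real_of_rat q) (at (real_of_rat q) within A)"
  using of_q_pos by (intro tendsto_intros) auto

lemma cross_bounds: "real (cross q j) \<le> real j / real_of_rat q" "real j / real_of_rat q < real (cross q j) + 1"
proof -
  have "int (cross q j) = \<lfloor>real j / real_of_rat q\<rfloor>"
    unfolding of_nat_divide_rat[OF q_pos] cross_def by (rule floor_divide_of_nat_eq[symmetric])
  then show "real (cross q j) \<le> real j / real_of_rat q" "real j / real_of_rat q < real (cross q j) + 1"
    by linarith+
qed

lemma cross_left_bounds:
  assumes "1 \<le> j"
  shows "real (cross_left q j) < real j / real_of_rat q" "real j / real_of_rat q \<le> real (cross_left q j) + 1"
proof -
  have pos: "1 \<le> j * n"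
    using assms n_pos by simp
  have "cross_left q j * m \<le> j * n - 1"
    by (simp add: cross_left_def)
  then have "cross_left q j * m < j * n"
    using pos by linarith
  then have "real (cross_left q j) * real m < real (j * n)"
    by (simp only: of_nat_mult[symmetric] of_nat_less_iff)
  then show "real (cross_left q j) < real j / real_of_rat q"
    unfolding of_nat_divide_rat[OF q_pos] using m_pos by (simp add: pos_less_divide_eq)
  have "j * n - 1 < (cross_left q j + 1) * m"
    unfolding cross_left_def using m_pos dividend_less_div_times[of m "j * n - 1"] by simp
  then have "j * n \<le> (cross_left q j + 1) * m"
    using pos by linarith
  then have "real (j * n) \<le> (real (cross_left q j) + 1) * real m"
    by (metis of_nat_1 of_nat_add of_nat_le_iff of_nat_mult)
  then show "real j / real_of_rat q \<le> real (cross_left q j) + 1"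
    unfolding of_nat_divide_rat[OF q_pos] using m_pos by (simp add: pos_divide_le_eq)
qed

text \<open>
  As \<open>x\<close> increases to \<open>q\<close>, \<open>j / x\<close> decreases to \<open>j / q\<close>, and the floor is continuous from the
  right.
\<close>

lemma near_below:
  obtains q0 where "0 \<le> q0" "q0 < real_of_rat q"
    "\<And>q'. q0 < real_of_rat q' \<Longrightarrow> q' < q \<Longrightarrow> N < numer q' \<and> (\<forall>j\<le>N. cross q' j = cross q j)"
proof -
  have "\<forall>\<^sub>F x in at_left (real_of_rat q). \<forall>j\<in>{..N}. real j / x < real (cross q j) + 1"
    using cross_bounds(2) divide_tendsto by (intro eventually_ball_finite ballI order_tendstoD(2)) auto
  then obtain r where r: "r < real_of_rat q"
    "\<forall>x>r. x < real_of_rat q \<longrightarrow> (\<forall>j\<in>{..N}. real j / x < real (cross q j) + 1)"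
    unfolding eventually_at_left_field by blast
  have "N < numer q' \<and> (\<forall>j\<le>N. cross q' j = cross q j)"
    if q': "max r 0 < real_of_rat q'" "q' < q" for q'
  proof -
    have pos: "0 < q'" and less: "real_of_rat q' < real_of_rat q"
      using q' by (auto simp: of_rat_less)
    have up: "real j / real_of_rat q' < real (cross q j) + 1" if "j \<le> N" for j
      using r(2) less that q' by simp
    have low: "real (cross q j) < real j / real_of_rat q'" if "1 \<le> j" for j
    proof -
      have "real j / real_of_rat q < real j / real_of_rat q'"
        using that less pos of_q_pos by (intro divide_strict_left_mono) auto
      then show ?thesis using cross_bounds(1)[of j] by linarith
    qed
    have "cross q' j = cross q j" if "j \<le> N" for j
    proof (cases "j = 0")
      case False
      then show ?thesis
        using low[of j] up[OF that] pos by (intro cross_eqI) auto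
    qed (simp add: cross_def)
    then show ?thesis
      using numer_gtI[OF pos, of N "cross q"] low up by blast
  qed
  then show ?thesis
    using that[of "max r 0"] r(1) of_q_pos by auto
qed

text \<open>
  As \<open>x\<close> decreases to \<open>q\<close>, \<open>j / x\<close> increases to \<open>j / q\<close> without reaching it, so its floor
  becomes the largest integer below \<open>j / q\<close>.
\<close>

lemma near_above:
  obtains q1 where "real_of_rat q < q1"
    "\<And>q'. real_of_rat q' < q1 \<Longrightarrow> q < q' \<Longrightarrow>
      N < numer q' \<and> (\<forall>j. 1 \<le> j \<longrightarrow> j \<le> N \<longrightarrow> cross q' j = cross_left q j)"
proof -
  have "\<forall>\<^sub>F x in at_right (real_of_rat q). \<forall>j\<in>{1..N}. real (cross_left q j) < real j / x"
    using cross_left_bounds(1) divide_tendsto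
    by (intro eventually_ball_finite ballI order_tendstoD(1)) auto
  then obtain r where r: "real_of_rat q < r"
    "\<forall>x>real_of_rat q. x < r \<longrightarrow> (\<forall>j\<in>{1..N}. real (cross_left q j) < real j / x)"
    unfolding eventually_at_right_field by blast
  have "N < numer q' \<and> (\<forall>j. 1 \<le> j \<longrightarrow> j \<le> N \<longrightarrow> cross q' j = cross_left q j)"
    if q': "real_of_rat q' < r" "q < q'" for q'
  proof -
    have pos: "0 < q'" and less: "real_of_rat q < real_of_rat q'"
      using q' q_pos by (auto simp: of_rat_less)
    have low: "real (cross_left q j) < real j / real_of_rat q'" if "1 \<le> j" "j \<le> N" for j
      using r(2) less that q' by simp
    have up: "real j / real_of_rat q' < real (cross_left q j) + 1" if "1 \<le> j" for j
    proof -
      have "real j / real_of_rat q' < real j / real_of_rat q"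
        using that less of_q_pos pos by (intro divide_strict_left_mono) auto
      then show ?thesis using cross_left_bounds(2)[OF that] by linarith
    qed
    have "cross q' j = cross_left q j" if "1 \<le> j" "j \<le> N" for j
      using low[OF that] up[OF that(1)] pos by (intro cross_eqI) auto
    then show ?thesis
      using numer_gtI[OF pos, of N "cross_left q"] low up by blast
  qed
  then show ?thesis
    using that[of r] r(1) by auto
qed

section \<open>The sequences rhe and lhe\<close>

lemma rhe_paired: "1 \<le> k \<Longrightarrow> paired (cross q) k (rhe q)"
  unfolding rhe_pair_seq by (rule pair_seq_paired[OF cross_spaced])

lemma rhe_cross: "1 \<le> k \<Longrightarrow> rhe q (cross q k) = 1"
  unfolding rhe_pair_seq pair_seq_1 by blast

lemma rhe_Suc_cross: "1 \<le> k \<Longrightarrow> rhe q (Suc (cross q k)) = 1"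
  unfolding rhe_pair_seq pair_seq_1 by blast

text \<open>
  Comparisons with the periodic sequences in the definition of height are decided within this
  prefix.
\<close>

lemma c_omega_nth: "r \<le> n \<Longrightarrow> word_omega (c_word q @ [0]) r = rhe q r"
  by (simp add: word_omega_def c_word_length nth_append c_word_nth rhe_pair_seq)

lemma c_omega_paired:
  assumes "1 \<le> k" "k \<le> m"
  shows "paired (cross q) k (word_omega (c_word q @ [0]))" "word_omega (c_word q @ [0]) (cross q k) = 1"
proof -
  have "cross q k \<le> n"
    using cross_le[OF assms(2)] by simp
  then show "paired (cross q) k (word_omega (c_word q @ [0]))" "word_omega (c_word q @ [0]) (cross q k) = 1"
    using c_omega_nth rhe_cross[OF assms(1)] by (auto intro!: paired_agree[OF rhe_paired[OF assms(1)]])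
qed

lemma rhe_before_n: "rhe q (n - 1) = 0" and rhe_n: "rhe q n = 1"
proof -
  show "rhe q n = 1"
    using rhe_cross[OF m_pos] by simp
  have "n - 1 \<noteq> cross q j \<and> n - 1 \<noteq> Suc (cross q j)" if "1 \<le> j" for j
  proof (cases "j < m")
    case True
    then have "inner_pair (cross q j)" "inner_pair (Suc (cross q j))"
      using that by (auto simp: inner_pair_def)
    then show ?thesis
      using inner_pair_bounds by fastforce
  next
    case False
    then show ?thesis using cross_le[of m j] n_pos by auto
  qed
  then show "rhe q (n - 1) = 0"
    unfolding rhe_pair_seq pair_seq_def using n_ge_2 by auto
qed

text \<open>
  The pairs met when a sequence with pairs at \<open>cross q\<close> is read backwards from position \<open>L\<close>: the
  pair at \<open>cross q i\<close>, \<open>cross q i + 1\<close> turns up at \<open>L - cross q i - 1\<close>, \<open>L - cross q i\<close>. The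
  initial \<open>1\<close> of the sequence is met at \<open>L\<close> and counts as the first member of the \<open>k\<close>-th pair.
\<close>

definition reversed_pairs :: "nat \<Rightarrow> nat \<Rightarrow> nat \<Rightarrow> nat" where
  "reversed_pairs k L i = (if i < k then L - cross q (k - i) - 1 else L)"

lemma reversed_paired:
  assumes k: "1 \<le> k" "cross q k \<le> L" and rev: "\<And>r. r \<le> L \<Longrightarrow> u r = t (L - r)"
    and tL: "t L = 1"
    and t: "\<And>x. 0 < x \<Longrightarrow> x < L \<Longrightarrow>
      t x = 1 \<longleftrightarrow> (\<exists>i. 1 \<le> i \<and> i < k \<and> (x = cross q i \<or> x = Suc (cross q i)))"
  shows "paired (reversed_pairs k L) k u"
  unfolding paired_def
proof (intro conjI allI impI)
  have small: "cross q i + 2 \<le> L" if "i < k" for i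
    using cross_less[OF that] k(2) by simp
  show "spaced (reversed_pairs k L) k"
    unfolding spaced_def
  proof (intro conjI allI impI)
    show "1 \<le> reversed_pairs k L 1"
      using small[of "k - 1"] small[of 0] k(1) by (auto simp: reversed_pairs_def)
    fix j assume j: "1 \<le> j \<and> j < k"
    show "reversed_pairs k L j + 2 \<le> reversed_pairs k L (Suc j)"
    proof (cases "Suc j = k")
      case True
      then have "k - j = 1" by simp
      then show ?thesis
        using True cross_1 small[of 1] j by (auto simp: reversed_pairs_def)
    next
      case False
      have "k - j = Suc (k - Suc j)"
        using j by (simp add: Suc_diff_Suc)
      then have "cross q (k - Suc j) + 2 \<le> cross q (k - j)"
        using cross_Suc[of "k - Suc j"] by simp
      then show ?thesis
        using False j small[of "k - j"] by (auto simp: reversed_pairs_def)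
    qed
  qed
  fix r assume "r < reversed_pairs k L k"
  then have r: "r < L"
    by (simp add: reversed_pairs_def)
  show "u r = 1 \<longleftrightarrow> r = 0 \<or> (\<exists>j. 1 \<le> j \<and> j < k \<and>
      (r = reversed_pairs k L j \<or> r = Suc (reversed_pairs k L j)))"
  proof (cases "r = 0")
    case True
    then show ?thesis using rev[of 0] tL by simp
  next
    case False
    have "u r = 1 \<longleftrightarrow> (\<exists>i. 1 \<le> i \<and> i < k \<and> (L - r = cross q i \<or> L - r = Suc (cross q i)))"
      using rev[of r] t[of "L - r"] r False by simp
    also have "\<dots> \<longleftrightarrow> (\<exists>j. 1 \<le> j \<and> j < k \<and>
      (r = reversed_pairs k L j \<or> r = Suc (reversed_pairs k L j)))"
    proof
      assume "\<exists>i. 1 \<le> i \<and> i < k \<and> (L - r = cross q i \<or> L - r = Suc (cross q i))"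
      then obtain i where "1 \<le> i" "i < k" "L - r = cross q i \<or> L - r = Suc (cross q i)"
        by blast
      then show "\<exists>j. 1 \<le> j \<and> j < k \<and> (r = reversed_pairs k L j \<or> r = Suc (reversed_pairs k L j))"
        using r small[of i] by (intro exI[of _ "k - i"]) (auto simp: reversed_pairs_def)
    next
      assume "\<exists>j. 1 \<le> j \<and> j < k \<and> (r = reversed_pairs k L j \<or> r = Suc (reversed_pairs k L j))"
      then obtain j where "1 \<le> j" "j < k" "r = reversed_pairs k L j \<or> r = Suc (reversed_pairs k L j)"
        by blast
      then show "\<exists>i. 1 \<le> i \<and> i < k \<and> (L - r = cross q i \<or> L - r = Suc (cross q i))"
        using r small[of "k - j"] by (intro exI[of _ "k - j"]) (auto simp: reversed_pairs_def)
    qed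
    finally show ?thesis using False by simp
  qed
qed

lemma rhe_interior:
  assumes "0 < x" "x < cross q k"
  shows "rhe q x = 1 \<longleftrightarrow> (\<exists>i. 1 \<le> i \<and> i < k \<and> (x = cross q i \<or> x = Suc (cross q i)))"
proof -
  have "1 \<le> k"
    using assms by (cases k) auto
  then show ?thesis
    using rhe_paired[of k] assms unfolding paired_def by simp
qed

end

locale strict_low_height = low_height +
  assumes q_less: "q < 1 / 2"
begin

lemma two_m_less: "2 * m < n"
proof -
  have "real_of_rat q < real_of_rat (1 / 2)"
    using q_less by (simp only: of_rat_less)
  then have "real m / real n < 1 / 2"
    using of_q by (simp add: of_rat_divide)
  then have "2 * real m < real n"
    using n_pos by (simp add: divide_less_eq)
  then show ?thesis by linarith
qed

lemma cross_left_eq: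
  assumes "1 \<le> j"
  shows "cross_left q j = (if m dvd j then cross q j - 1 else cross q j)"
proof -
  have "m dvd j * n \<longleftrightarrow> m dvd j"
    using coprime_mn by (simp add: coprime_dvd_mult_left_iff)
  then show ?thesis
    using div_pred[of "j * n" m] assms n_pos by (simp add: cross_left_def cross_def)
qed

lemma cross_left_spaced: "spaced (cross_left q) k"
proof -
  have step: "cross_left q j + 2 \<le> cross_left q (Suc j)" if "1 \<le> j" for j
  proof -
    have "cross_left q j + n div m \<le> (j * n - 1 + n) div m"
      unfolding cross_left_def by (rule div_add_le)
    also have "j * n - 1 + n = Suc j * n - 1"
      using that n_pos by simp
    finally show ?thesis
      using cross_1 by (simp add: cross_left_def cross_def)
  qed
  have "1 \<le> cross_left q 1"
    using two_m_less m_pos by (simp add: cross_left_def less_eq_div_iff_mult_less_eq)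
  then show ?thesis
    using step by (auto simp: spaced_def)
qed

lemma lhe_mod: "lhe q r = 1 \<longleftrightarrow> r mod n = 0 \<or> r mod n = n - 1 \<or> inner_pair (r mod n)"
proof -
  let ?i = "r mod n"
  have i: "?i < n"
    using n_pos by simp
  have len: "length (w_word q @ [1]) = n"
    using w_word_length n_pos by simp
  have lhe: "lhe q r = (w_word q @ [1]) ! ?i"
    unfolding lhe_def word_omega_def len ..
  consider "?i = n - 1" | "?i < n - 1"
    using i by linarith
  then show ?thesis
  proof cases
    case 1
    then show ?thesis
      unfolding lhe using w_word_length by (simp add: nth_append)
  next
    case 2
    then have eq: "lhe q r = pair_seq (cross q) ?i"
      unfolding lhe using w_word_length by (simp add: nth_append w_word_nth)
    consider "?i = 0" | "?i = 1" | "2 \<le> ?i" by linarith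
    then show ?thesis
    proof cases
      case 1
      then show ?thesis unfolding eq pair_seq_1 by simp
    next
      case 2
      have "\<not> inner_pair 1"
        using inner_pair_bounds[of 1] by auto
      moreover have "pair_seq (cross q) 1 \<noteq> 1"
        unfolding pair_seq_1 using cross_le[of 1] cross_1 by fastforce
      ultimately show ?thesis
        using 2 \<open>?i < n - 1\<close> unfolding eq by simp
    next
      case 3
      then show ?thesis
        using pair_seq_mod[OF 3] 2 unfolding eq by simp
    qed
  qed
qed

text \<open>
  The last pair of each period occupies positions \<open>n - 1\<close> and \<open>n\<close>, one step further to the left
  than in \<open>rhe q\<close>.
\<close>

lemma lhe_pair_seq: "lhe q = pair_seq (cross_left q)"
proof (rule ext, rule bit_eqI)
  fix r
  show "lhe q r = 1 \<longleftrightarrow> pair_seq (cross_left q) r = 1"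
    unfolding lhe_mod
  proof
    assume *: "r mod n = 0 \<or> r mod n = n - 1 \<or> inner_pair (r mod n)"
    let ?k = "r div n"
    have r: "r = r mod n + ?k * n" by simp
    have full: "cross_left q (k * m) = k * n - 1" if "1 \<le> k" for k
      using cross_left_eq[of "k * m"] cross_add_mult[of 0 k] that m_pos by simp
    consider "r = 0" | "r mod n = 0" "1 \<le> ?k" | "r mod n = n - 1" | "inner_pair (r mod n)"
      using * r by (cases "?k = 0") auto
    then show "pair_seq (cross_left q) r = 1"
    proof cases
      case 1
      then show ?thesis by (simp add: pair_seq_1)
    next
      case 2
      then have "r = Suc (cross_left q (?k * m))"
        using full[of ?k] r n_pos by (cases ?k) auto
      then show ?thesis
        unfolding pair_seq_1 using 2 m_pos by (intro disjI2 exI[of _ "?k * m"]) auto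
    next
      case 3
      then have "r = cross_left q (Suc ?k * m)"
        using full[of "Suc ?k"] r n_pos by simp
      then show ?thesis
        unfolding pair_seq_1 using m_pos by (intro disjI2 exI[of _ "Suc ?k * m"]) auto
    next
      case 4
      then obtain i where i: "1 \<le> i" "i < m" "r mod n = cross q i \<or> r mod n = Suc (cross q i)"
        by (auto simp: inner_pair_def)
      have "\<not> m dvd i + ?k * m"
        using i by (auto simp: dvd_add_left_iff dest: dvd_imp_le)
      then have "cross_left q (i + ?k * m) = cross q i + ?k * n"
        using cross_left_eq[of "i + ?k * m"] cross_add_mult i by simp
      then have "r = cross_left q (i + ?k * m) \<or> r = Suc (cross_left q (i + ?k * m))"
        using i(3) r by linarith
      then show ?thesis
        unfolding pair_seq_1 using i by (intro disjI2 exI[of _ "i + ?k * m"]) auto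
    qed
  next
    assume "pair_seq (cross_left q) r = 1"
    then consider "r = 0" | j where "1 \<le> j" "r = cross_left q j \<or> r = Suc (cross_left q j)"
      by (auto simp: pair_seq_1)
    then show "r mod n = 0 \<or> r mod n = n - 1 \<or> inner_pair (r mod n)"
    proof cases
      case 2
      obtain i k where ik: "j = i + k * m" "i < m" "cross q j = cross q i + k * n"
        using cross_split by blast
      show ?thesis
      proof (cases "i = 0")
        case True
        then obtain k' where k': "k = Suc k'"
          using 2 ik by (cases k) auto
        have "cross_left q j = k * n - 1"
          using cross_left_eq[OF 2(1)] ik True by simp
        then have "r = (n - 1) + k' * n \<or> r = 0 + k * n"
          using 2(2) k' n_pos by auto
        then have "r mod n = (n - 1) mod n \<or> r mod n = 0 mod n"
          by (metis mod_mult_self1)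
        then show ?thesis
          using n_pos by auto
      next
        case False
        have "\<not> m dvd j"
          using ik False by (auto simp: dvd_add_left_iff dest: dvd_imp_le)
        then have "r = cross q i + k * n \<or> r = Suc (cross q i) + k * n"
          using 2 cross_left_eq[OF 2(1)] ik by auto
        moreover have inner_pair: "inner_pair (cross q i)" "inner_pair (Suc (cross q i))"
          using False ik by (auto simp: inner_pair_def intro!: exI[of _ i])
        ultimately have "r mod n = cross q i \<or> r mod n = Suc (cross q i)"
          using inner_pair_bounds[OF inner_pair(2)] 
          by (metis Suc_lessD add_2_eq_Suc' less_eq_Suc_le mod_less mod_mult_self1
              order_less_le_trans lessI)
        then show ?thesis using inner_pair by auto
      qed
    qed auto
  qed
qed

lemma lhe_paired: "1 \<le> k \<Longrightarrow> paired (cross_left q) k (lhe q)"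
  unfolding lhe_pair_seq by (rule pair_seq_paired[OF cross_left_spaced])

lemma shift_lhe: "shift n (lhe q) = lhe q"
  by (intro ext bit_eqI) (simp add: shift_apply lhe_mod)

lemma lhe_rhe_agree: "r < n - 1 \<Longrightarrow> lhe q r = rhe q r"
  using w_word_length w_word_nth[of r] n_pos
  by (simp add: lhe_def word_omega_def nth_append rhe_pair_seq)

lemma lhe_before_n: "lhe q (n - 1) = 1"
  using lhe_mod[of "n - 1"] n_pos by simp

lemma odd_ones_before_n: "odd (ones (rhe q) (n - 1))"
proof -
  have "odd (ones (rhe q) n)"
    using paired_odd[OF rhe_paired[OF m_pos] m_pos] by simp
  moreover have "n = Suc (n - 1)"
    using n_pos by simp
  ultimately show ?thesis
    using rhe_before_n ones_Suc[of "rhe q" "n - 1"] by simp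
qed

lemma even_ones_lhe: "even (ones (lhe q) n)"
proof -
  have "ones (lhe q) (n - 1) = ones (rhe q) (n - 1)"
    by (intro ones_cong lhe_rhe_agree)
  moreover have "n = Suc (n - 1)"
    using n_pos by simp
  ultimately show ?thesis
    using lhe_before_n odd_ones_before_n ones_Suc[of "lhe q" "n - 1"] by simp
qed

end

section \<open>Bounds on the height of the kneading sequence\<close>

lemma height_le:
  assumes "0 < q'" "q' \<le> 1 / 2" "unimodal_less (word_omega (c_word q' @ [0])) s"
  shows "height s \<le> real_of_rat q'"
  unfolding height_def
  by (rule cInf_lower) (use assms in \<open>auto intro!: bdd_belowI[of _ 0]\<close>)

lemma height_witness:
  assumes "height s < y" "y \<le> 1 / 2"
  obtains q' where "0 < q'" "q' \<le> 1 / 2" "unimodal_less (word_omega (c_word q' @ [0])) s"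
    "real_of_rat q' < y"
  using cInf_lessD[OF _ assms(1)[unfolded height_def]] assms(2) by auto

text \<open>
  Let \<open>L\<close> be the position of the second \<open>1\<close> in the kneading sequence. If \<open>q' < 1 / (L + 1)\<close>, the
  word \<open>c_word q'\<close> has a longer first block of zeros and therefore is greater than the kneading
  sequence.
\<close>

lemma (in tent) height_K_pos: "0 < height K"
proof -
  define L where "L = (LEAST L. 1 \<le> L \<and> K L = 1)"
  have L: "1 \<le> L" "K L = 1"
    using LeastI_ex[OF K_one_again] by (auto simp: L_def)
  have "K r = 0" if "1 \<le> r" "r < L" for r
    using not_less_Least[of r "\<lambda>L. 1 \<le> L \<and> K L = 1"] that by (auto simp: L_def)
  then have "K r = 1 \<longleftrightarrow> r = 0" if "r < L" for r
    using that K_0 by (cases "r = 0") auto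
  then have pK: "paired (\<lambda>_. L) 1 K"
    using L by (auto simp: paired_def spaced_def)
  have "1 / (real L + 1) \<le> real_of_rat q'"
    if q': "0 < q'" "q' \<le> 1 / 2" "unimodal_less (word_omega (c_word q' @ [0])) K" for q'
  proof (rule ccontr)
    assume *: "\<not> 1 / (real L + 1) \<le> real_of_rat q'"
    interpret low_height q'
      using q' by unfold_locales
    have "real L + 1 < 1 / real_of_rat q'"
      using * of_q_pos by (simp add: field_simps)
    then have "L < cross q' 1"
      using cross_bounds(2)[of 1] by simp
    then have "unimodal_less K (word_omega (c_word q' @ [0]))"
      using m_pos by (intro paired_less[OF pK _ c_omega_paired(1), of 1]) (auto simp: L)
    then show False
      using q'(3) unimodal_less_asym by blast
  qed
  then have "min (1 / 2) (1 / (real L + 1)) \<le> height K"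
    unfolding height_def by (intro cInf_greatest) (auto simp: min_le_iff_disj)
  moreover have "0 < min (1 / 2) (1 / (real L + 1))"
    by simp
  ultimately show ?thesis by linarith
qed

text \<open>
  By the position of \<open>f a\<close> relative to the fixed point, the kneading sequence is \<open>1 0\<close>, followed
  by an even number \<open>k\<close> of ones and a zero. For \<open>q'\<close> slightly below \<open>1 / 2\<close> the word \<open>c_word q'\<close>
  is \<open>1 0\<close> followed by more than \<open>k\<close> ones, which is less.
\<close>

lemma (in tent) height_K_less_half: "height K < 1 / 2"
proof -
  obtain k where k: "\<forall>i<k. shift 2 K i = 1" "shift 2 K k \<noteq> 1" "even (ones (shift 2 K) (Suc k))"
    using shift_2_K_less unfolding unimodal_less_iff by blast
  have "ones (shift 2 K) k = k"
    using k(1)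
  proof (induction k)
    case (Suc k)
    then show ?case by (simp add: ones_Suc)
  qed simp
  then have "even k"
    using k(2,3) by (simp add: ones_Suc)
  then obtain i where i: "k = 2 * i" by blast
  interpret half: low_height "1 / 2"
    by unfold_locales auto
  have "real half.n = 2 * real half.m"
    using half.of_q half.n_pos by (simp add: of_rat_divide field_simps)
  then have "half.n = 2 * half.m"
    by linarith
  then have cross_half: "cross (1 / 2) j = 2 * j" for j
    using half.m_pos by (simp add: cross_def mult.assoc[symmetric])
  obtain q0 where q0: "0 \<le> q0" "q0 < real_of_rat (1 / 2)"
    "\<And>q'. q0 < real_of_rat q' \<Longrightarrow> q' < 1 / 2 \<Longrightarrow>
      Suc i < numer q' \<and> (\<forall>j\<le>Suc i. cross q' j = cross (1 / 2) j)"
    using half.near_below[of "Suc i"] by blast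
  obtain q' where q': "q0 < real_of_rat q'" "real_of_rat q' < real_of_rat (1 / 2)"
    using of_rat_dense[OF q0(2)] by blast
  then have less: "q' < 1 / 2"
    by (simp only: of_rat_less)
  have "0 < real_of_rat q'"
    using q' q0(1) by linarith
  then have pos: "0 < q'" by simp
  interpret low_height q'
    using pos less by unfold_locales auto
  have m: "Suc i \<le> m" and cross: "cross q' j = 2 * j" if "j \<le> Suc i" for j
    using q0(3)[OF q'(1) less] cross_half that by auto
  let ?s = "word_omega (c_word q' @ [0])"
  have s: "paired (cross q') (Suc i) ?s" "?s (cross q' (Suc i)) = 1"
    using c_omega_paired[of "Suc i"] q0(3)[OF q'(1) less] by auto
  have pos_i: "cross q' (Suc i) = k + 2"
    using cross[of "Suc i"] i by simp
  have "unimodal_less ?s K"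
    unfolding unimodal_less_iff
  proof (intro exI[of _ "k + 2"] conjI allI impI)
    show "?s (k + 2) \<noteq> K (k + 2)"
      using s(2) k(2) pos_i by (auto simp: shift_apply)
    show "even (ones ?s (Suc (k + 2)))"
      using paired_odd[OF s(1)] s(2) pos_i by (simp add: ones_Suc)
    fix r assume r: "r < k + 2"
    have s_iff: "?s r = 1 \<longleftrightarrow> r = 0 \<or> (\<exists>j. 1 \<le> j \<and> j < Suc i \<and> (r = 2 * j \<or> r = Suc (2 * j)))"
      using s(1) cross r pos_i unfolding paired_def by (metis less_imp_le_nat)
    consider "r = 0" | "r = 1" | "2 \<le> r" by linarith
    then show "?s r = K r"
    proof cases
      case 3
      have "K r = 1"
        using k(1)[rule_format, of "r - 2"] 3 r by (simp add: shift_apply del: add_2_eq_Suc)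
      moreover have "r = 2 * (r div 2) \<or> r = Suc (2 * (r div 2))"
        by presburger
      then have "?s r = 1"
        unfolding s_iff using 3 r i by (intro disjI2 exI[of _ "r div 2"]) auto
      ultimately show ?thesis by simp
    next
      case 1
      then show ?thesis
        using s_iff K_0 by simp
    next
      case 2
      have "\<not> (\<exists>j. 1 \<le> j \<and> j < Suc i \<and> (r = 2 * j \<or> r = Suc (2 * j)))"
        using 2 by auto
      then have "?s r \<noteq> 1"
        using 2 unfolding s_iff by simp
      then show ?thesis
        using 2 K_1 by simp
    qed
  qed
  then have "height K \<le> real_of_rat q'"
    using height_le pos less by simp
  also have "\<dots> < 1 / 2"
    using q'(2) by (simp add: of_rat_divide)
  finally show ?thesis .
qed

section \<open>The greatest backward sequence\<close>

locale rational_interior = tent a b c lam f + strict_low_height q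
  for a b c lam f q +
  assumes height_K: "height (kneading a b c f) = real_of_rat q"
    and K_not_lhe: "kneading a b c f \<noteq> lhe q"
    and K_not_rhe: "kneading a b c f \<noteq> rhe q"
begin

text \<open>
  If the kneading sequence were greater than \<open>rhe q\<close>, it would be so on account of finitely many
  symbols, which \<open>rhe q\<close> shares with \<open>c_word q'\<close> for some \<open>q' < q\<close>. Then the height would be at
  most \<open>q'\<close>.
\<close>

lemma K_less_rhe: "unimodal_less K (rhe q)"
proof -
  have "\<not> unimodal_less (rhe q) K"
  proof
    assume "unimodal_less (rhe q) K"
    then obtain k where k: "1 \<le> k" "\<forall>r<cross q k. K r = rhe q r" "K (cross q k) = 0"
      using pair_seq_less_first_difference[OF cross_spaced] unfolding rhe_pair_seq by blast
    obtain q0 where q0: "0 \<le> q0" "q0 < real_of_rat q"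
      "\<And>q'. q0 < real_of_rat q' \<Longrightarrow> q' < q \<Longrightarrow> k < numer q' \<and> (\<forall>j\<le>k. cross q' j = cross q j)"
      using near_below[of k] by blast
    obtain q' where q': "q0 < real_of_rat q'" "real_of_rat q' < real_of_rat q"
      using of_rat_dense[OF q0(2)] by blast
    then have less: "q' < q"
      by (simp only: of_rat_less)
    have "0 < real_of_rat q'"
      using q' q0(1) by linarith
    then have pos: "0 < q'" by simp
    have half: "q' \<le> 1 / 2"
      using less q_half by simp
    interpret q': low_height q'
      using pos half by unfold_locales
    have eq: "k \<le> numer q'" "\<forall>j\<le>k. cross q' j = cross q j"
      using q0(3)[OF q'(1) less] by auto
    let ?s = "word_omega (c_word q' @ [0])"
    have s: "paired (cross q') k ?s" "?s (cross q k) = 1"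
      using q'.c_omega_paired[OF k(1) eq(1)] eq(2) by auto
    have "unimodal_less ?s K"
      unfolding unimodal_less_iff
    proof (intro exI[of _ "cross q k"] conjI allI impI)
      show "?s r = K r" if "r < cross q k" for r
        using paired_cong[OF s(1) rhe_paired[OF k(1)], of r] eq(2) that k(2) by simp
      show "?s (cross q k) \<noteq> K (cross q k)"
        using s(2) k(3) by simp
      show "even (ones ?s (Suc (cross q k)))"
        using paired_odd[OF s(1) k(1)] s(2) eq(2) by (simp add: ones_Suc)
    qed
    then have "height K \<le> real_of_rat q'"
      using height_le pos half by blast
    then show False
      using q'(2) height_K by simp
  qed
  then show ?thesis
    using K_not_rhe unimodal_linear by blast
qed

text \<open>
  By the assumption \<open>q\<close> itself does not witness the height, so there are witnesses \<open>q' > q\<close>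
  arbitrarily close to \<open>q\<close>. Their words approximate \<open>lhe q\<close>.
\<close>

lemma lhe_less_K:
  assumes "\<not> unimodal_less (word_omega (c_word q @ [0])) K"
  shows "unimodal_less (lhe q) K"
proof -
  have "\<not> unimodal_less K (lhe q)"
  proof
    assume less: "unimodal_less K (lhe q)"
    then obtain r where r: "K r \<noteq> lhe q r"
      unfolding unimodal_less_iff by blast
    obtain q1 where q1: "real_of_rat q < q1"
      "\<And>q'. real_of_rat q' < q1 \<Longrightarrow> q < q' \<Longrightarrow>
        Suc r < numer q' \<and> (\<forall>j. 1 \<le> j \<longrightarrow> j \<le> Suc r \<longrightarrow> cross q' j = cross_left q j)"
      using near_above[of "Suc r"] by blast
    have "real_of_rat q < real_of_rat (1 / 2)"
      using q_less by (simp only: of_rat_less)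
    then have "height K < min q1 (1 / 2)"
      using q1(1) height_K by (simp add: of_rat_divide)
    then obtain q' where q': "0 < q'" "q' \<le> 1 / 2"
      "unimodal_less (word_omega (c_word q' @ [0])) K" "real_of_rat q' < min q1 (1 / 2)"
      using height_witness[of K "min q1 (1 / 2)"] min.cobounded2 by metis
    interpret q': low_height q'
      using q' by unfold_locales
    have "real_of_rat q \<le> real_of_rat q'"
      using height_le[OF q'(1-3)] height_K by simp
    moreover have "q' \<noteq> q"
      using assms q'(3) by blast
    ultimately have "q < q'"
      by (simp add: of_rat_less_eq)
    then have eq: "Suc r \<le> numer q'" "\<forall>j. 1 \<le> j \<longrightarrow> j \<le> Suc r \<longrightarrow> cross q' j = cross_left q j"
      using q1(2)[of q'] q'(4) by auto
    let ?s = "word_omega (c_word q' @ [0])"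
    have s: "paired (cross q') (Suc r) ?s"
      using q'.c_omega_paired[of "Suc r"] eq(1) by auto
    have "Suc r \<le> cross_left q (Suc r)"
      by (rule spaced_ge[OF cross_left_spaced]) auto
    then have "\<forall>i<Suc r. ?s i = lhe q i"
      using paired_cong[OF s lhe_paired[of "Suc r"]] eq(2) by auto
    then have "unimodal_less K ?s"
      by (intro unimodal_less_agree[OF less, of "Suc r"]) (use r in auto)
    then show False
      using q'(3) unimodal_less_asym by blast
  qed
  then show ?thesis
    using K_not_lhe unimodal_linear by blast
qed

text \<open>
  Both \<open>lhe q\<close> and \<open>rhe q\<close> start with \<open>w_word q\<close>, hence so does a sequence between them. If the
  next symbol is \<open>0\<close>, the one after it must be \<open>1\<close> to stay below \<open>rhe q\<close>. If it is \<open>1\<close>, then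
  after removing the even word formed by \<open>w_word q\<close> and this \<open>1\<close> the sequence is again greater
  than \<open>lhe q\<close> and, as a shift of the kneading sequence, not greater than the latter; so it
  starts with the same word again, and inductively it is \<open>lhe q\<close>.
\<close>

lemma K_prefix: "\<forall>r<Suc n. K r = rhe q r"
proof (cases "unimodal_less (word_omega (c_word q @ [0])) K")
  case True
  then show ?thesis
    using K_less_rhe c_omega_nth
    by (intro unimodal_between[of "word_omega (c_word q @ [0])" K "rhe q"]) (auto simp: unimodal_le_def)
next
  case False
  note lhe_less = lhe_less_K[OF this]
  have w: "\<forall>r<n - 1. K r = rhe q r"
    using lhe_less K_less_rhe lhe_rhe_agree
    by (intro unimodal_between[of "lhe q" K "rhe q"]) (auto simp: unimodal_le_def)
  have n1: "Suc (n - 1) = n"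
    using n_pos by simp
  have K_odd: "odd (ones K (n - 1))"
    using odd_ones_before_n ones_cong[of "n - 1" K "rhe q"] w by simp
  have "K (n - 1) \<noteq> 1"
  proof
    assume K1: "K (n - 1) = 1"
    have K_lhe: "\<forall>r<n. K r = lhe q r"
    proof (intro allI impI)
      fix r assume "r < n"
      then have "r < n - 1 \<or> r = n - 1" by linarith
      then show "K r = lhe q r"
        using w lhe_rhe_agree lhe_before_n K1 by auto
    qed
    have step: "unimodal_less (lhe q) (shift (j * n) K) \<and> (\<forall>r<n. shift (j * n) K r = lhe q r)" for j
    proof (induction j)
      case 0
      then show ?case using lhe_less K_lhe by simp
    next
      case (Suc j)
      let ?T = "shift (j * n) K"
      have "unimodal_less (shift n (lhe q)) (shift n ?T)"
        using unimodal_less_shift[of n "lhe q" ?T] Suc even_ones_lhe by simp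
      then have less: "unimodal_less (lhe q) (shift (Suc j * n) K)"
        by (simp add: shift_lhe add.commute)
      moreover have "\<forall>r<n. shift (Suc j * n) K r = K r"
        using unimodal_between[of "lhe q" "shift (Suc j * n) K" K n] less shift_K_le K_lhe
        by (simp add: unimodal_le_def)
      ultimately show ?case
        using K_lhe by simp
    qed
    have "K r = lhe q r" for r
    proof -
      have "K r = shift (r div n * n) K (r mod n)"
        by (simp add: shift_apply)
      also have "\<dots> = lhe q (r mod n)"
        using step[of "r div n"] n_pos by simp
      also have "\<dots> = lhe q r"
        by (intro bit_eqI) (simp add: lhe_mod)
      finally show ?thesis .
    qed
    then show False
      using K_not_lhe by blast
  qed
  then have K0: "K (n - 1) = 0" by simp
  have agree: "\<forall>r<n. K r = rhe q r"
  proof (intro allI impI)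
    fix r assume "r < n"
    then have "r < n - 1 \<or> r = n - 1" by linarith
    then show "K r = rhe q r"
      using w rhe_before_n K0 by auto
  qed
  have "K n = 1"
  proof (rule ccontr)
    assume "K n \<noteq> 1"
    have "odd (ones (rhe q) n)"
      using paired_odd[OF rhe_paired[OF m_pos] m_pos] by simp
    then have "unimodal_less (rhe q) K"
      using agree rhe_n \<open>K n \<noteq> 1\<close> unfolding unimodal_less_iff
      by (intro exI[of _ n]) (auto simp: ones_Suc)
    then show False
      using K_less_rhe unimodal_less_asym by blast
  qed
  then show ?thesis
    using agree rhe_n by (auto simp: less_Suc_eq)
qed

lemma K_paired:
  assumes "1 \<le> k" "k \<le> m"
  shows "paired (cross q) k K"
proof -
  have "cross q k \<le> n"
    using cross_le[OF assms(2)] by simp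
  then show ?thesis
    using K_prefix by (intro paired_agree[OF rhe_paired[OF assms(1)]]) auto
qed

lemma odd_ones_K: "odd (ones K n)"
  using paired_odd[OF K_paired[OF m_pos order_refl] m_pos] by simp

text \<open>
  The tail that starts at the first \<open>1\<close> beyond the place where the past exceeds \<open>rhe q\<close> has its
  first \<open>k\<close> pairs at least as far to the right as \<open>rhe q\<close>, by superadditivity of \<open>cross\<close>, and
  the \<open>k\<close>-th pair strictly further.
\<close>

lemma backward_le_rhe:
  assumes S: "S \<in> biitineraries a b c f"
  shows "unimodal_le (backward S) (rhe q)"
proof (rule ccontr)
  define t where "t = backward S"
  assume "\<not> unimodal_le (backward S) (rhe q)"
  then have "unimodal_less (rhe q) t"
    by (simp add: unimodal_le_iff t_def)
  then obtain k where k: "1 \<le> k" "\<forall>r<cross q k. t r = rhe q r" "t (cross q k) = 0"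
    using pair_seq_less_first_difference[OF cross_spaced] unfolding rhe_pair_seq by blast
  obtain j where j: "j < - 1 - int (cross q k)" "S j = 1"
    using biitineraries_one_left[OF S] by blast
  define L where "L = (LEAST L. cross q k < L \<and> t L = 1)"
  have "cross q k < nat (- 1 - j) \<and> t (nat (- 1 - j)) = 1"
    using j by (simp add: t_def backward_def)
  then have L: "cross q k < L" "t L = 1"
    using LeastI[of "\<lambda>L. cross q k < L \<and> t L = 1"] unfolding L_def by blast+
  have zero: "t x \<noteq> 1" if "cross q k \<le> x" "x < L" for x
  proof (cases "x = cross q k")
    case False
    then show ?thesis
      using not_less_Least[of x "\<lambda>L. cross q k < L \<and> t L = 1"] that by (auto simp: L_def)
  qed (use k in simp)
  have t_iff: "t x = 1 \<longleftrightarrow> (\<exists>i. 1 \<le> i \<and> i < k \<and> (x = cross q i \<or> x = Suc (cross q i)))"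
    if "0 < x" "x < L" for x
  proof (cases "x < cross q k")
    case True
    then show ?thesis using k(2) rhe_interior that by simp
  next
    case False
    then have "\<not> (\<exists>i. 1 \<le> i \<and> i < k \<and> (x = cross q i \<or> x = Suc (cross q i)))"
      using cross_less by fastforce
    then show ?thesis
      using zero[of x] False that by simp
  qed
  define u where "u = tail (- 1 - int L) S"
  have u: "u r = t (L - r)" if "r \<le> L" for r
  proof -
    have "- 1 - int L + int r = - 1 - int (L - r)"
      using that by (simp add: of_nat_diff)
    then show ?thesis
      by (simp only: u_def t_def tail_def backward_def)
  qed
  \<comment> \<open>Beyond the position where \<open>t\<close> exceeds \<open>rhe q\<close> there are only zeros up to \<open>L\<close>,
    so the pairs of \<open>t\<close> before \<open>L\<close> are the first \<open>k - 1\<close> pairs of \<open>rhe q\<close>.\<close>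
  have "paired (reversed_pairs k L) k u"
    using reversed_paired[OF k(1) _ u L(2) t_iff] L(1) by simp
  then have "unimodal_less (rhe q) u"
  proof (rule paired_less[OF rhe_paired[OF k(1)] rhe_cross[OF k(1)] _ _ k(1) order_refl])
    show "\<forall>j. 1 \<le> j \<and> j \<le> k \<longrightarrow> cross q j \<le> reversed_pairs k L j"
    proof (intro allI impI)
      fix j assume "1 \<le> j \<and> j \<le> k"
      then show "cross q j \<le> reversed_pairs k L j"
        using cross_add_le[of j "k - j"] L(1) by (auto simp: reversed_pairs_def)
    qed
    show "cross q k < reversed_pairs k L k"
      using L(1) by (simp add: reversed_pairs_def)
  qed
  moreover have "unimodal_less u (rhe q)"
    using biitineraries_tail_le[OF S] K_less_rhe unimodal_le_less_trans unfolding u_def by blast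
  ultimately show False
    using unimodal_less_asym by blast
qed

text \<open>
  The sequence \<open>u\<close> is \<open>rhe q\<close> read backwards from \<open>p\<close>, continued by \<open>v\<close> with its initial \<open>1\<close>
  identified with that of \<open>rhe q\<close>. Only starting points at the first member of a pair are not
  immediate. From the \<open>j\<close>-th pair, the pairs of \<open>u\<close> are at most as far to the right as those of
  \<open>rhe q\<close>, hence of the kneading sequence as far as it is known. For \<open>j > m\<close> the \<open>m\<close>-th pair is
  strictly further to the left, by one. For \<open>j \<le> m\<close> all pairs may coincide, and then \<open>v\<close>
  decides.
\<close>

lemma reversed_rhe_le_K:
  assumes rev: "\<And>r. r \<le> p \<Longrightarrow> u r = rhe q (p - r)" and shift: "shift p u = v"
    and v: "v 0 = 1" "v 1 = 0" "unimodal_le (shift n K) v" and p: "1 \<le> p"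
  shows "unimodal_le u K"
proof -
  consider "rhe q p = 0" | j where "1 \<le> j" "p = Suc (cross q j)" | j where "1 \<le> j" "p = cross q j"
  proof (cases "rhe q p = 0")
    case True
    then show ?thesis using that by blast
  next
    case False
    then have "\<exists>j\<ge>1. p = cross q j \<or> p = Suc (cross q j)"
      using p unfolding rhe_pair_seq by (simp add: pair_seq_1)
    then show ?thesis using that by blast
  qed
  then show ?thesis
  proof cases
    case 1
    then have "unimodal_less u K"
      using rev[of 0] K_0 by (intro unimodal_less_01) auto
    then show ?thesis by (simp add: unimodal_le_def)
  next
    case 2
    then have "unimodal_less u K"
      using rev[of 0] rev[of 1] K_0 K_1 rhe_cross rhe_Suc_cross
      by (intro unimodal_less_11_10) auto
    then show ?thesis by (simp add: unimodal_le_def)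
  next
    case (3 j)
    have up: "paired (reversed_pairs j p) j u"
      using rhe_interior 3 by (intro reversed_paired[OF 3(1) _ rev rhe_cross[OF 3(1), folded 3(2)]]) auto
    have le: "reversed_pairs j p i \<le> cross q i" if "i \<le> j" for i
      using cross_add_ge[of i "j - i"] that 3 by (auto simp: reversed_pairs_def)
    have final: "u (reversed_pairs j p j) = 1"
      using rev[of p] by (simp add: reversed_pairs_def rhe_pair_seq pair_seq_1)
    show ?thesis
    proof (cases "m < j")
      case True
      have um: "paired (reversed_pairs j p) m u"
        using paired_mono[OF up m_pos] True by simp
      have "j = (j - m) + m"
        using True by simp
      then have cj: "p = cross q (j - m) + n"
        using cross_add_m[of "j - m"] 3 by metis
      then have eq: "reversed_pairs j p m = n - 1"
        using True by (simp add: reversed_pairs_def)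
      have "reversed_pairs j p m < reversed_pairs j p j"
        using eq cj n_pos by (simp add: reversed_pairs_def)
      then have "u (reversed_pairs j p m) = 1"
        using up True m_pos unfolding paired_def by auto
      then have "unimodal_less u K"
        by (rule paired_less[OF um _ K_paired[OF m_pos order_refl] _ m_pos order_refl])
          (use le True eq n_pos in auto)
      then show ?thesis by (simp add: unimodal_le_def)
    next
      case False
      then have Kj: "paired (cross q) j K"
        using K_paired 3 by simp
      show ?thesis
      proof (cases "\<exists>i. 1 \<le> i \<and> i \<le> j \<and> reversed_pairs j p i < cross q i")
        case True
        then obtain i where "1 \<le> i" "i \<le> j" "reversed_pairs j p i < cross q i" by blast
        then have "unimodal_less u K"
          using le by (intro paired_less[OF up final Kj]) auto
        then show ?thesis by (simp add: unimodal_le_def)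
      next
        case False
        then have eq: "\<forall>i. 1 \<le> i \<and> i < j \<longrightarrow> cross q i = reversed_pairs j p i"
          using le by (metis le_antisym less_imp_le_nat not_le)
        have agree: "\<forall>i<p. K i = u i"
          using paired_cong[OF Kj up eq] 3 by (simp add: reversed_pairs_def)
        have "odd (ones K p)"
          using paired_odd[OF Kj] 3 by simp
        then have "unimodal_less K u \<longleftrightarrow> unimodal_less v (shift p K)"
          using unimodal_less_shift[OF agree] shift by simp
        moreover have "\<not> unimodal_less v (shift p K)"
        proof (cases "j = m")
          case True
          then show ?thesis
            using v(3) 3 by (simp add: unimodal_le_iff)
        next
          case False
          then have "j < m"
            using \<open>\<not> m < j\<close> by simp
          then have "Suc p < n"
            using cross_less[of j m] 3 by simp
          then have "K p = 1" "K (Suc p) = 1"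
            using K_prefix 3 rhe_cross rhe_Suc_cross by auto
          then have "unimodal_less (shift p K) v"
            using v by (intro unimodal_less_11_10) (auto simp: shift_apply)
          then show ?thesis
            using unimodal_less_asym by blast
        qed
        ultimately show ?thesis by (simp add: unimodal_le_iff)
      qed
    qed
  qed
qed

text \<open>
  The future is the itinerary of a point \<open>x\<close> close to \<open>b\<close>. It has to lie to the right of the
  \<open>n\<close>-th iterate of \<open>b\<close>, which is possible since that iterate is not \<open>b\<close>: the prefix of length
  \<open>n\<close> of the kneading sequence is odd, whereas a period would be even. The other lower bound for
  \<open>x\<close> ensures \<open>f x < c\<close>.
\<close>

lemma rhe_attained: "\<exists>S\<in>biitineraries a b c f. backward S = rhe q"
proof -
  have "(f ^^ n) b \<noteq> b"
    using even_ones_period[of n] odd_ones_K n_pos by blast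
  then have fn: "(f ^^ n) b < b"
    using iterate_in[OF b_in, of n] by auto
  have "c + (b - c) / lam < b"
  proof -
    have "(b - c) / lam < (b - c) / 1"
      using cb lam_gt_1 by (intro divide_strict_left_mono) auto
    then show ?thesis by simp
  qed
  then obtain x where x: "max ((f ^^ n) b) (c + (b - c) / lam) < x" "x < b" "x \<in> {a..b}"
    "\<forall>r. (f ^^ r) x \<noteq> c"
    using off_turning_point[of "max ((f ^^ n) b) (c + (b - c) / lam)"] fn by auto
  define v :: "nat \<Rightarrow> bit" where "v = (\<lambda>r. if (f ^^ r) x < c then 0 else 1)"
  have it: "is_itinerary a b c f x v"
    unfolding v_def by (rule off_turning_itinerary[OF x(3,4)])
  have "0 < (b - c) / lam"
    using cb lam_gt_1 by simp
  then have xc: "c < x"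
    using x(1) by simp
  have "(b - c) / lam < x - c"
    using x(1) by simp
  then have "b - c < lam * (x - c)"
    using lam_gt_1 by (simp add: divide_less_eq mult.commute)
  then have "f x < c"
    using f_right[of x] xc x(2) by simp
  then have v01: "v 0 = 1" "v 1 = 0"
    using xc by (auto simp: v_def)
  have "\<not> unimodal_less v (shift n K)"
    using x(1) follows_mono[OF x(3) itinerary_follows[OF x(3) it]
        iterate_in[OF b_in] follows_shift[OF follows_K], of n]
    by auto
  then have v_ge: "unimodal_le (shift n K) v"
    by (simp add: unimodal_le_iff)
  define S where "S i = (if i < 0 then rhe q (nat (- 1 - i)) else v (nat (i + 1)))" for i :: int
  have past: "backward S = rhe q"
    by (auto simp: backward_def S_def)
  have S_neg: "S (- 1 - int r) = rhe q r" for r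
    by (simp add: S_def)
  have tail_v: "tail (- 1) S = v"
  proof
    fix r
    show "tail (- 1) S r = v r"
      using v01(1) by (cases r) (auto simp: tail_def S_def rhe_pair_seq pair_seq_1 nat_add_distrib)
  qed
  have le: "unimodal_le (tail i S) K" for i
  proof (cases "- 1 \<le> i")
    case True
    then have "tail i S = shift (nat (i + 1)) v"
      using tail_v shift_tail[of "nat (i + 1)" "- 1" S] by simp
    then show ?thesis
      using itinerary_le_K[OF iterate_in[OF x(3)] itinerary_shift[OF it]] by simp
  next
    case False
    define p where "p = nat (- 1 - i)"
    have i: "i = - 1 - int p" "1 \<le> p"
      using False by (auto simp: p_def)
    show ?thesis
    proof (rule reversed_rhe_le_K[OF _ _ v01 v_ge i(2)])
      show "tail i S r = rhe q (p - r)" if "r \<le> p" for r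
        using S_neg[of "p - r"] that by (simp add: tail_def i(1) of_nat_diff algebra_simps)
      show "shift p (tail i S) = v"
        using tail_v by (simp add: i(1))
    qed
  qed
  have one: "\<exists>j<i. S j = 1" for i
  proof (intro exI conjI)
    let ?k = "Suc (nat (- i))"
    have "?k \<le> cross q ?k"
      by (rule spaced_ge[OF cross_spaced]) auto
    then show "- 1 - int (cross q ?k) < i"
      by linarith
    show "S (- 1 - int (cross q ?k)) = 1"
      unfolding S_neg by (rule rhe_cross) auto
  qed
  have "S \<in> biitineraries a b c f"
    using biitineraries_intro[OF le one x(3,4)] it tail_v by metis
  then show ?thesis
    using past by blast
qed

end

theorem theorem17:
  fixes a b c lam :: real and f :: "real \<Rightarrow> real" and q :: rat
  assumes "tent_map a b c lam f"
    and "sqrt 2 < lam" and "lam < 2"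
    and "rational_interior_type a b c f"
    and "height (kneading a b c f) = real_of_rat q"
  shows "(\<exists>S\<in>biitineraries a b c f. backward S = rhe q) \<and>
         (\<forall>t. (\<exists>S\<in>biitineraries a b c f. backward S = t) \<longrightarrow> unimodal_le t (rhe q))"
proof -
  interpret tent a b c lam f
    using assms by unfold_locales
  have "0 < real_of_rat q"
    using height_K_pos assms(5) by simp
  then have pos: "0 < q" by simp
  have "real_of_rat q < real_of_rat (1 / 2)"
    using height_K_less_half assms(5) by (simp add: of_rat_divide)
  then have less: "q < 1 / 2"
    by (simp only: of_rat_less)
  interpret rational_interior a b c lam f q
    using pos less assms(4,5) by unfold_locales (auto simp: rational_interior_type_def)
  show ?thesis
    using rhe_attained backward_le_rhe by blast
qed

end
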